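(* Let $G$ be a finite group acting on a compactly generated Hausdorff path connected space $X$ with basepoint $x_0$, and let $n\ge 1$. Let $G_0$ be the subgroup of $G$ consisting of those elements $g$ which, considered as homeomorphisms of $X$, are freely homotopic to the identity map $1_X$. Then the sequence $$1\to G\tau_n(X,x_0)\to G\sigma_n(X,x_0,G)\xrightarrow{p_n} G_0\to 1$$ is exact, where $p_n([f;g])=g$ and $G\tau_n(X,x_0)\to G\sigma_n(X,x_0,G)$ is the map $[f]\mapsto[f;e]$, with $e\in G$ the identity element.
   Context: Let $I=[0,1]$, let $T^{m}$ denote the $m$-dimensional torus ($T^0$ is a point), and for $n\ge 1$ put $C_n=I\times T^{n-1}$. Fox torus homotopy groups: for a space $Z$ with basepoint $z_0$, $\tau_n(Z,z_0)=\pi_1(Z^{T^{n-1}},c_{z_0})$, where $Z^{T^{n-1}}$ is the space of maps $T^{n-1}\to Z$ and $c_{z_0}$ is the constant map at $z_0$. Rhodes groups: let $Z$ be a $G$-space with basepoint $z_0$. A map $f:C_n\to Z$ is of order $g\in G$ if $f(0,t_2,\ldots,t_n)=z_0$ and $f(1,t_2,\ldots,t_n)=gz_0$ for all $(t_2,\ldots,t_n)\in T^{n-1}$. Let $[f;g]$ denote the homotopy class of $f$ through maps of order $g$ (together with $g$), and let $\sigma_n(Z,z_0,G)$ be the set of all such classes. It is a group under $[f';g']*[f;g]=[f'+g'f;\,g'g]$, where $g'f$ is the map $f$ followed by the action of $g'$ and $+$ denotes concatenation in the $I$-coordinate. This definition is applied also to spaces $Z$ that are not path connected. Let $X^X$ be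 the space of maps $X\to X$ with the pointwise $G$-action $(gf)(x)=gf(x)$, and let $ev:X^X\to X$ be evaluation at $x_0$. The Gottlieb-Fox group is $G\tau_n(X,x_0)=\mathrm{Im}(ev_*:\tau_n(X^X,1_X)\to\tau_n(X,x_0))$, and the Gottlieb-Rhodes group is $G\sigma_n(X,x_0,G)=\mathrm{Im}(ev_*:\sigma_n(X^X,1_X,G)\to\sigma_n(X,x_0,G))$. *)

theory Defs
  imports "HOL-Analysis.Analysis" "HOL-Algebra.Group_Action"
begin

section \<open>Mapping spaces\<close>

text \<open>Maps are represented by extensional functions, so that a continuous map
  corresponds to exactly one point of the mapping space.  The topology is the compact-open one.\<close>

definition mapping_space :: "'a topology \<Rightarrow> 'b topology \<Rightarrow> ('a \<Rightarrow> 'b) topology" where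
  "mapping_space T Z = topology_generated_by
     {{f \<in> extensional (topspace T). continuous_map T Z f \<and> f ` K \<subseteq> U} | K U.
        compactin T K \<and> openin Z U}"

lemma topspace_mapping_space:
  "topspace (mapping_space T Z) = {f \<in> extensional (topspace T). continuous_map T Z f}"
proof -
  have "compactin T {}" "openin Z {}"
    by auto
  then show ?thesis
    unfolding mapping_space_def topology_generated_by_topspace by blast
qed

definition id_map :: "'a topology \<Rightarrow> 'a \<Rightarrow> 'a" where
  "id_map X = (\<lambda>x\<in>topspace X. x)"

definition torus :: "nat \<Rightarrow> (nat \<Rightarrow> complex) topology" where
  "torus m = product_topology (\<lambda>_. top_of_set (sphere 0 1)) {..<m}"

definition cylinder :: "nat \<Rightarrow> (real \<times> (nat \<Rightarrow> complex)) topology" where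
  "cylinder n = prod_topology (top_of_set {0..1}) (torus (n - 1))"


section \<open>Fundamental group and Fox torus homotopy groups\<close>

text \<open>Operations on homotopy classes are given by the union, over all representatives, of the
  classes of the results; this is the class of the result as soon as the operation
  respects homotopy.\<close>

definition is_loop :: "'a topology \<Rightarrow> 'a \<Rightarrow> (real \<Rightarrow> 'a) \<Rightarrow> bool" where
  "is_loop Z z0 f \<longleftrightarrow> pathin Z f \<and> f 0 = z0 \<and> f 1 = z0"

definition loop_class :: "'a topology \<Rightarrow> 'a \<Rightarrow> (real \<Rightarrow> 'a) \<Rightarrow> (real \<Rightarrow> 'a) set" where
  "loop_class Z z0 f =
     {f'. homotopic_with (\<lambda>h. h 0 = z0 \<and> h 1 = z0) (top_of_set {0..1}) Z f f'}"

definition loop_concat :: "(real \<Rightarrow> 'a) \<Rightarrow> (real \<Rightarrow> 'a) \<Rightarrow> real \<Rightarrow> 'a" where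
  "loop_concat f' f = (\<lambda>t. if t \<le> 1/2 then f' (2 * t) else f (2 * t - 1))"

definition fundamental_group :: "'a topology \<Rightarrow> 'a \<Rightarrow> (real \<Rightarrow> 'a) set monoid" where
  "fundamental_group Z z0 =
     \<lparr>carrier = {loop_class Z z0 f | f. is_loop Z z0 f},
      mult = (\<lambda>c' c. \<Union>f'\<in>c'. \<Union>f\<in>c. loop_class Z z0 (loop_concat f' f)),
      one = loop_class Z z0 (\<lambda>_. z0)\<rparr>"

definition const_map :: "nat \<Rightarrow> 'a \<Rightarrow> (nat \<Rightarrow> complex) \<Rightarrow> 'a" where
  "const_map n z0 = (\<lambda>s\<in>topspace (torus (n - 1)). z0)"

definition fox_group ::
    "nat \<Rightarrow> 'a topology \<Rightarrow> 'a \<Rightarrow> (real \<Rightarrow> (nat \<Rightarrow> complex) \<Rightarrow> 'a) set monoid" where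
  "fox_group n Z z0 = fundamental_group (mapping_space (torus (n - 1)) Z) (const_map n z0)"

definition fox_class ::
    "nat \<Rightarrow> 'a topology \<Rightarrow> 'a \<Rightarrow> (real \<Rightarrow> (nat \<Rightarrow> complex) \<Rightarrow> 'a)
      \<Rightarrow> (real \<Rightarrow> (nat \<Rightarrow> complex) \<Rightarrow> 'a) set" where
  "fox_class n Z z0 f = loop_class (mapping_space (torus (n - 1)) Z) (const_map n z0) f"

definition fox_induced ::
    "nat \<Rightarrow> 'b topology \<Rightarrow> 'b \<Rightarrow> ('a \<Rightarrow> 'b)
      \<Rightarrow> (real \<Rightarrow> (nat \<Rightarrow> complex) \<Rightarrow> 'a) set \<Rightarrow> (real \<Rightarrow> (nat \<Rightarrow> complex) \<Rightarrow> 'b) set" where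
  "fox_induced n W w0 h c =
     (\<Union>f\<in>c. fox_class n W w0 (\<lambda>t. compose (topspace (torus (n - 1))) h (f t)))"


section \<open>Rhodes groups\<close>

text \<open>For a finite (discrete) group, continuity of the action is continuity of each translation.\<close>

definition G_space :: "('g, 'r) monoid_scheme \<Rightarrow> 'a topology \<Rightarrow> ('g \<Rightarrow> 'a \<Rightarrow> 'a) \<Rightarrow> bool" where
  "G_space G Z \<phi> \<longleftrightarrow>
     group_action G (topspace Z) \<phi> \<and> (\<forall>g\<in>carrier G. continuous_map Z Z (\<phi> g))"

definition order_ends ::
    "nat \<Rightarrow> 'a \<Rightarrow> ('g \<Rightarrow> 'a \<Rightarrow> 'a) \<Rightarrow> 'g \<Rightarrow> (real \<times> (nat \<Rightarrow> complex) \<Rightarrow> 'a) \<Rightarrow> bool" where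
  "order_ends n z0 \<phi> g f \<longleftrightarrow>
     (\<forall>s\<in>topspace (torus (n - 1)). f (0, s) = z0 \<and> f (1, s) = \<phi> g z0)"

definition of_order ::
    "nat \<Rightarrow> 'a topology \<Rightarrow> 'a \<Rightarrow> ('g \<Rightarrow> 'a \<Rightarrow> 'a) \<Rightarrow> 'g
      \<Rightarrow> (real \<times> (nat \<Rightarrow> complex) \<Rightarrow> 'a) \<Rightarrow> bool" where
  "of_order n Z z0 \<phi> g f \<longleftrightarrow> continuous_map (cylinder n) Z f \<and> order_ends n z0 \<phi> g f"

definition order_class ::
    "nat \<Rightarrow> 'a topology \<Rightarrow> 'a \<Rightarrow> ('g \<Rightarrow> 'a \<Rightarrow> 'a) \<Rightarrow> 'g
      \<Rightarrow> (real \<times> (nat \<Rightarrow> complex) \<Rightarrow> 'a) \<Rightarrow> (real \<times> (nat \<Rightarrow> complex) \<Rightarrow> 'a) set" where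
  "order_class n Z z0 \<phi> g f =
     {f'. homotopic_with (order_ends n z0 \<phi> g) (cylinder n) Z f f'}"

definition cyl_concat ::
    "(real \<times> 't \<Rightarrow> 'a) \<Rightarrow> (real \<times> 't \<Rightarrow> 'a) \<Rightarrow> real \<times> 't \<Rightarrow> 'a" where
  "cyl_concat f' f = (\<lambda>(t, s). if t \<le> 1/2 then f' (2 * t, s) else f (2 * t - 1, s))"

text \<open>The element \<open>[f; g]\<close> is the pair \<open>(order_class n Z z0 \<phi> g f, g)\<close>.\<close>

definition rhodes_group ::
    "nat \<Rightarrow> 'a topology \<Rightarrow> 'a \<Rightarrow> ('g, 'r) monoid_scheme \<Rightarrow> ('g \<Rightarrow> 'a \<Rightarrow> 'a)
      \<Rightarrow> ((real \<times> (nat \<Rightarrow> complex) \<Rightarrow> 'a) set \<times> 'g) monoid" where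
  "rhodes_group n Z z0 G \<phi> =
     \<lparr>carrier = {(order_class n Z z0 \<phi> g f, g) | f g. g \<in> carrier G \<and> of_order n Z z0 \<phi> g f},
      mult = (\<lambda>(c', g') (c, g).
        (\<Union>f'\<in>c'. \<Union>f\<in>c. order_class n Z z0 \<phi> (g' \<otimes>\<^bsub>G\<^esub> g) (cyl_concat f' (\<phi> g' \<circ> f)),
         g' \<otimes>\<^bsub>G\<^esub> g)),
      one = (order_class n Z z0 \<phi> \<one>\<^bsub>G\<^esub> (\<lambda>_. z0), \<one>\<^bsub>G\<^esub>)\<rparr>"

definition rhodes_induced ::
    "nat \<Rightarrow> 'b topology \<Rightarrow> 'b \<Rightarrow> ('g \<Rightarrow> 'b \<Rightarrow> 'b) \<Rightarrow> ('a \<Rightarrow> 'b)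
      \<Rightarrow> (real \<times> (nat \<Rightarrow> complex) \<Rightarrow> 'a) set \<times> 'g
      \<Rightarrow> (real \<times> (nat \<Rightarrow> complex) \<Rightarrow> 'b) set \<times> 'g" where
  "rhodes_induced n W w0 \<psi> h = (\<lambda>(c, g). (\<Union>f\<in>c. order_class n W w0 \<psi> g (h \<circ> f), g))"


section \<open>Gottlieb-Fox and Gottlieb-Rhodes groups\<close>

definition pointwise_action :: "'a topology \<Rightarrow> ('g \<Rightarrow> 'a \<Rightarrow> 'a) \<Rightarrow> 'g \<Rightarrow> ('a \<Rightarrow> 'a) \<Rightarrow> 'a \<Rightarrow> 'a" where
  "pointwise_action X \<phi> g = (\<lambda>f\<in>topspace (mapping_space X X). compose (topspace X) (\<phi> g) f)"

definition gottlieb_fox_group ::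
    "nat \<Rightarrow> 'a topology \<Rightarrow> 'a \<Rightarrow> (real \<Rightarrow> (nat \<Rightarrow> complex) \<Rightarrow> 'a) set monoid" where
  "gottlieb_fox_group n X x0 = (fox_group n X x0)
     \<lparr>carrier := fox_induced n X x0 (\<lambda>F. F x0) ` carrier (fox_group n (mapping_space X X) (id_map X))\<rparr>"

definition gottlieb_rhodes_group ::
    "nat \<Rightarrow> 'a topology \<Rightarrow> 'a \<Rightarrow> ('g, 'r) monoid_scheme \<Rightarrow> ('g \<Rightarrow> 'a \<Rightarrow> 'a)
      \<Rightarrow> ((real \<times> (nat \<Rightarrow> complex) \<Rightarrow> 'a) set \<times> 'g) monoid" where
  "gottlieb_rhodes_group n X x0 G \<phi> = (rhodes_group n X x0 G \<phi>)
     \<lparr>carrier := rhodes_induced n X x0 \<phi> (\<lambda>F. F x0) `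
        carrier (rhodes_group n (mapping_space X X) (id_map X) G (pointwise_action X \<phi>))\<rparr>"

definition homotopic_id_subgroup ::
    "'a topology \<Rightarrow> ('g, 'r) monoid_scheme \<Rightarrow> ('g \<Rightarrow> 'a \<Rightarrow> 'a) \<Rightarrow> ('g, 'r) monoid_scheme" where
  "homotopic_id_subgroup X G \<phi> =
     G\<lparr>carrier := {g \<in> carrier G. homotopic_with (\<lambda>_. True) X X (\<phi> g) (id_map X)}\<rparr>"

text \<open>The map \<open>[f] \<mapsto> [f; e]\<close>: a loop in the space of maps from the torus is read as a map on the
  cylinder.\<close>

definition fox_to_rhodes ::
    "nat \<Rightarrow> 'a topology \<Rightarrow> 'a \<Rightarrow> ('g, 'r) monoid_scheme \<Rightarrow> ('g \<Rightarrow> 'a \<Rightarrow> 'a)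
      \<Rightarrow> (real \<Rightarrow> (nat \<Rightarrow> complex) \<Rightarrow> 'a) set
      \<Rightarrow> (real \<times> (nat \<Rightarrow> complex) \<Rightarrow> 'a) set \<times> 'g" where
  "fox_to_rhodes n Z z0 G \<phi> c =
     (\<Union>f\<in>c. order_class n Z z0 \<phi> \<one>\<^bsub>G\<^esub> (\<lambda>(t, s). f t s), \<one>\<^bsub>G\<^esub>)"

definition rhodes_proj ::
    "(real \<times> (nat \<Rightarrow> complex) \<Rightarrow> 'a) set \<times> 'g \<Rightarrow> 'g" where
  "rhodes_proj = snd"

text \<open>Exactness of \<open>1 \<rightarrow> A \<rightarrow> B \<rightarrow> C \<rightarrow> 1\<close>. The library's \<open>short_exact_sequence\<close>
  requires all groups to have elements of one type.\<close>

definition short_exact ::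
    "('a, 'r) monoid_scheme \<Rightarrow> ('a \<Rightarrow> 'b) \<Rightarrow> ('b, 's) monoid_scheme \<Rightarrow> ('b \<Rightarrow> 'c)
      \<Rightarrow> ('c, 't) monoid_scheme \<Rightarrow> bool" where
  "short_exact A i B p C \<longleftrightarrow>
     group_hom A B i \<and> group_hom B C p \<and>
     kernel A B i = {\<one>\<^bsub>A\<^esub>} \<and>
     kernel B C p = i ` carrier A \<and>
     p ` carrier B = carrier C"

end

theory Submission
  imports Defs
begin

text \<open>Write \<open>M\<close> for the space of self-maps of \<open>X\<close>. Evaluation at \<open>x0\<close> is an equivariant pointed map
from \<open>M\<close> to \<open>X\<close>, and both Gottlieb groups are images under homomorphisms that it induces. So
the exact sequence comes from statements about an arbitrary pointed \<open>G\<close>-space \<open>Z\<close>, applied to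
\<open>M\<close> and to \<open>X\<close> and compared through evaluation.

For every \<open>Z\<close> the Rhodes classes form a group, because the usual reparametrizations of the
interval prove the group laws and a homotopy keeps the order of a map
(\<open>group_rhodes_group\<close>). The assignment \<open>[f] \<mapsto> [f; e]\<close> is injective from the Fox group into the Rhodes
group, and its image is the kernel of \<open>[f; g] \<mapsto> g\<close> (\<open>inj_on_fox_to_rhodes\<close>,
\<open>fox_to_rhodes_image\<close>): by the exponential law for the compact Hausdorff torus, loops in
the space of maps from the torus to \<open>Z\<close>, and homotopies of such loops, are the same as maps of
order \<open>e\<close> on the cylinder and their homotopies. The group laws of the Fox group
are therefore inherited from the Rhodes group. All of this is natural in \<open>Z\<close>
(\<open>fox_induced_natural\<close>).

Now \<open>[f; e]\<close> lies in the Gottlieb-Rhodes group whenever \<open>[f]\<close> lies in the Gottlieb-Fox group, by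
naturality. A class of the Gottlieb-Rhodes group with second component \<open>e\<close> is the image
under evaluation of a class over \<open>M\<close> with second component \<open>e\<close>; that class comes from the
Fox group of \<open>M\<close>, so exactness in the middle follows by naturality again.
Surjectivity onto \<open>G\<^sub>0\<close> is a second use of the exponential law (\<open>homotopic_to_id_iff_order_map\<close>):
a map of order \<open>g\<close> into \<open>M\<close> restricts to a path from the identity to \<open>g\<close>, which is a homotopy
because \<open>X\<close> is a Hausdorff k-space, and conversely a homotopy gives a map of order \<open>g\<close>
that does not depend on the torus coordinate.\<close>

section \<open>The exponential law for the compact-open topology\<close>

lemma continuous_map_into_mapping_space:
  assumes F: "\<And>y. y \<in> topspace Y \<Longrightarrow> F y \<in> topspace (mapping_space T Z)"
    and pre: "\<And>K U. compactin T K \<Longrightarrow> openin Z U \<Longrightarrow> openin Y {y \<in> topspace Y. F y ` K \<subseteq> U}"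
  shows "continuous_map Y (mapping_space T Z) F"
proof -
  let ?S = "{{f \<in> extensional (topspace T). continuous_map T Z f \<and> f ` K \<subseteq> U} | K U.
        compactin T K \<and> openin Z U}"
  have "continuous_map Y (topology_generated_by ?S) F"
  proof (rule continuous_on_generated_topo)
    fix B assume "B \<in> ?S"
    then obtain K U where B: "B = {f \<in> extensional (topspace T). continuous_map T Z f \<and> f ` K \<subseteq> U}"
      and K: "compactin T K" and U: "openin Z U"
      by blast
    have "F -` B \<inter> topspace Y = {y \<in> topspace Y. F y ` K \<subseteq> U}"
      using F unfolding B topspace_mapping_space by blast
    then show "openin Y (F -` B \<inter> topspace Y)"
      using pre[OF K U] by simp
  next
    have "\<Union> ?S = topspace (mapping_space T Z)"
      unfolding mapping_space_def topology_generated_by_topspace ..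
    then show "F ` topspace Y \<subseteq> \<Union> ?S"
      using F by blast
  qed
  then show ?thesis
    unfolding mapping_space_def .
qed

text \<open>This direction holds for arbitrary spaces: if \<open>h\<close> maps \<open>{y} \<times> K\<close> into \<open>U\<close> with \<open>K\<close> compact, the
tube lemma gives a neighbourhood \<open>V\<close> of \<open>y\<close> such that \<open>h\<close> maps \<open>V \<times> K\<close> into \<open>U\<close>.\<close>

lemma continuous_map_curry:
  assumes h: "continuous_map (prod_topology Y T) Z h"
  shows "continuous_map Y (mapping_space T Z) (\<lambda>y. \<lambda>t\<in>topspace T. h (y, t))"
proof (rule continuous_map_into_mapping_space)
  let ?F = "\<lambda>y. \<lambda>t\<in>topspace T. h (y, t)"
  show "?F y \<in> topspace (mapping_space T Z)" if "y \<in> topspace Y" for y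
  proof -
    have "continuous_map T Z (h \<circ> (\<lambda>t. (y, t)))"
      by (rule continuous_map_compose[OF _ h]) (simp add: continuous_map_pairwise o_def that)
    then have "continuous_map T Z (?F y)"
      by (rule continuous_map_eq) auto
    then show ?thesis
      by (simp add: topspace_mapping_space)
  qed
  fix K U assume K: "compactin T K" and U: "openin Z U"
  let ?W = "{p \<in> topspace (prod_topology Y T). h p \<in> U}"
  have W: "openin (prod_topology Y T) ?W"
    using h U by (rule openin_continuous_map_preimage)
  have KT: "K \<subseteq> topspace T"
    using K by (rule compactin_subset_topspace)
  show "openin Y {y \<in> topspace Y. ?F y ` K \<subseteq> U}"
  proof (subst openin_subopen, intro ballI)
    fix y assume y: "y \<in> {y \<in> topspace Y. ?F y ` K \<subseteq> U}"
    have "{y} \<times> K \<subseteq> ?W"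
    proof
      fix p assume "p \<in> {y} \<times> K"
      then obtain k where k: "p = (y, k)" "k \<in> K" by blast
      then have "?F y k \<in> U" using y by blast
      then show "p \<in> ?W" using y k KT by auto
    qed
    with y obtain V V' where V: "openin Y V" "y \<in> V" "K \<subseteq> V'" "V \<times> V' \<subseteq> ?W"
      using tube_lemma_right[OF W K, of y] by auto
    have "V \<subseteq> {y \<in> topspace Y. ?F y ` K \<subseteq> U}"
    proof
      fix v assume v: "v \<in> V"
      moreover have "v \<in> topspace Y"
        using v V(1) openin_subset by blast
      moreover have "?F v k \<in> U" if "k \<in> K" for k
        using v V(3,4) KT that by auto
      ultimately show "v \<in> {y \<in> topspace Y. ?F y ` K \<subseteq> U}"
        by blast
    qed
    with V show "\<exists>V. openin Y V \<and> y \<in> V \<and> V \<subseteq> {y \<in> topspace Y. ?F y ` K \<subseteq> U}"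
      by blast
  qed
qed

lemma openin_mapping_space_subbasic:
  assumes "compactin T K" "openin Z U"
  shows "openin (mapping_space T Z) {f \<in> topspace (mapping_space T Z). f ` K \<subseteq> U}"
proof -
  have "{f \<in> topspace (mapping_space T Z). f ` K \<subseteq> U}
      = {f \<in> extensional (topspace T). continuous_map T Z f \<and> f ` K \<subseteq> U}"
    by (auto simp: topspace_mapping_space)
  also have "openin (mapping_space T Z) \<dots>"
    unfolding mapping_space_def by (rule topology_generated_by_Basis) (use assms in blast)
  finally show ?thesis .
qed

text \<open>The converse direction needs enough compact neighbourhoods in the source. A compact subspace \<open>K\<close>
of a Hausdorff space is regular, so a point \<open>t\<close> has a closed, hence compact, neighbourhood \<open>C\<close> in \<open>K\<close>
with \<open>F y ` C \<subseteq> U\<close>; the condition \<open>f ` C \<subseteq> U\<close> is open in the mapping space, so it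
persists for parameters near \<open>y\<close>.\<close>

lemma continuous_map_uncurry_compactin:
  assumes F: "continuous_map Y (mapping_space T Z) F"
    and T: "Hausdorff_space T" and K: "compactin T K"
  shows "continuous_map (prod_topology Y (subtopology T K)) Z (\<lambda>(y, t). F y t)"
proof -
  let ?K = "subtopology T K"
  have tK: "topspace ?K = K"
    using compactin_subset_topspace[OF K] by auto
  have cK: "compact_space ?K"
    using K by (simp add: compact_space_subtopology)
  have "neighbourhood_base_of (closedin ?K) ?K"
    using cK T by (simp add: neighbourhood_base_of_closedin compact_Hausdorff_imp_regular_space Hausdorff_space_subtopology)
  note nb = this[unfolded neighbourhood_base_of, rule_format]
  have Fy: "continuous_map T Z (F y)" if "y \<in> topspace Y" for y
    using F that by (auto simp: continuous_map_def topspace_mapping_space Pi_iff)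
  show ?thesis
    unfolding continuous_map_def
  proof (intro conjI allI impI)
    show "(\<lambda>(y, t). F y t) \<in> topspace (prod_topology Y ?K) \<rightarrow> topspace Z"
      using Fy by (auto simp: continuous_map_def)
    fix U assume U: "openin Z U"
    let ?W = "{p \<in> topspace (prod_topology Y ?K). (case p of (y, t) \<Rightarrow> F y t) \<in> U}"
    show "openin (prod_topology Y ?K) ?W"
      unfolding openin_prod_topology_alt
    proof (intro allI impI)
      fix y t assume "(y, t) \<in> ?W"
      then have y: "y \<in> topspace Y" and t: "t \<in> K" and ytU: "F y t \<in> U"
        using tK by auto
      have cont: "continuous_map ?K Z (F y)"
        using Fy[OF y] by (rule continuous_map_from_subtopology)
      then have "openin ?K {s \<in> topspace ?K. F y s \<in> U} \<and> t \<in> {s \<in> topspace ?K. F y s \<in> U}"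
        using openin_continuous_map_preimage[OF cont U] t ytU unfolding tK by simp
      then obtain V C where V: "openin ?K V" "closedin ?K C" "t \<in> V" "V \<subseteq> C"
          "C \<subseteq> {s \<in> topspace ?K. F y s \<in> U}"
        using nb by meson
      have C: "compactin T C"
        using closedin_compact_space[OF cK V(2)] by (simp add: compactin_subtopology)
      let ?N = "{v \<in> topspace Y. F v \<in> {f \<in> topspace (mapping_space T Z). f ` C \<subseteq> U}}"
      have N: "openin Y ?N"
        by (rule openin_continuous_map_preimage[OF F openin_mapping_space_subbasic[OF C U]])
      have "y \<in> ?N"
        using y V(5) F by (auto simp: continuous_map_def)
      moreover have "?N \<times> V \<subseteq> ?W"
        using V(4) openin_subset[OF V(1)] by (auto simp: image_subset_iff)
      ultimately show "\<exists>N V. openin Y N \<and> openin ?K V \<and> y \<in> N \<and> t \<in> V \<and> N \<times> V \<subseteq> ?W"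
        using N V(1,3) by blast
    qed
  qed
qed

text \<open>A compact subset of \<open>Y \<times> T\<close> lies in \<open>Y \<times> K\<close> for its compact projection \<open>K\<close> to \<open>T\<close>, and
continuity on compact subsets suffices in a k-space. The hypothesis on the product is
satisfied in two situations below: when \<open>T\<close> is a torus and \<open>Y\<close> is compact, and when \<open>T\<close> is a
k-space and \<open>Y\<close> is the unit interval.\<close>

lemma continuous_map_uncurry:
  assumes F: "continuous_map Y (mapping_space T Z) F"
    and T: "Hausdorff_space T" and k: "k_space (prod_topology Y T)"
  shows "continuous_map (prod_topology Y T) Z (\<lambda>(y, t). F y t)"
proof (rule continuous_map_from_k_space[OF k])
  fix K assume K: "compactin (prod_topology Y T) K"
  have sK: "compactin T (snd ` K)"
    using image_compactin[OF K continuous_map_snd] .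
  have sub: "K \<subseteq> topspace Y \<times> snd ` K"
    using compactin_subset_topspace[OF K] by force
  have "continuous_map (subtopology (prod_topology Y T) (topspace Y \<times> snd ` K)) Z (\<lambda>(y, t). F y t)"
    using continuous_map_uncurry_compactin[OF F T sK] by (simp add: prod_topology_subtopology)
  then show "continuous_map (subtopology (prod_topology Y T) K) Z (\<lambda>(y, t). F y t)"
    using sub by (rule continuous_map_from_subtopology_mono)
qed

lemma continuous_map_postcompose:
  assumes h: "continuous_map Z W h"
  shows "continuous_map (mapping_space T Z) (mapping_space T W) (compose (topspace T) h)"
proof (rule continuous_map_into_mapping_space)
  fix f assume "f \<in> topspace (mapping_space T Z)"
  then have f: "continuous_map T Z f"
    by (simp add: topspace_mapping_space)
  have "continuous_map T W (compose (topspace T) h f)"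
    by (rule continuous_map_eq[OF continuous_map_compose[OF f h]]) (simp add: compose_def)
  then show "compose (topspace T) h f \<in> topspace (mapping_space T W)"
    by (simp add: topspace_mapping_space)
next
  fix K U assume K: "compactin T K" and U: "openin W U"
  have "{f \<in> topspace (mapping_space T Z). compose (topspace T) h f ` K \<subseteq> U}
      = {f \<in> topspace (mapping_space T Z). f ` K \<subseteq> {z \<in> topspace Z. h z \<in> U}}"
  proof (rule Collect_cong, rule conj_cong[OF refl])
    fix f assume "f \<in> topspace (mapping_space T Z)"
    then have "f k \<in> topspace Z \<and> compose (topspace T) h f k = h (f k)" if "k \<in> K" for k
      using that compactin_subset_topspace[OF K]
      by (auto simp: continuous_map_def compose_def topspace_mapping_space)
    then show "compose (topspace T) h f ` K \<subseteq> U \<longleftrightarrow> f ` K \<subseteq> {z \<in> topspace Z. h z \<in> U}"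
      by (simp add: image_subset_iff)
  qed
  then show "openin (mapping_space T Z)
      {f \<in> topspace (mapping_space T Z). compose (topspace T) h f ` K \<subseteq> U}"
    using openin_mapping_space_subbasic[OF K openin_continuous_map_preimage[OF h U]] by simp
qed

lemma continuous_map_eval_at:
  assumes t: "t \<in> topspace T"
  shows "continuous_map (mapping_space T Z) Z (\<lambda>f. f t)"
  unfolding continuous_map_def
proof (intro conjI allI impI)
  show "(\<lambda>f. f t) \<in> topspace (mapping_space T Z) \<rightarrow> topspace Z"
    using t by (auto simp: topspace_mapping_space continuous_map_def)
  fix U assume "openin Z U"
  then show "openin (mapping_space T Z) {f \<in> topspace (mapping_space T Z). f t \<in> U}"
    using openin_mapping_space_subbasic[of T "{t}" Z U] t by simp
qed

lemma compact_space_torus: "compact_space (torus m)"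
  unfolding torus_def by (simp add: compact_space_product_topology compact_space_subtopology)

lemma Hausdorff_space_torus: "Hausdorff_space (torus m)"
  unfolding torus_def by (simp add: Hausdorff_space_product_topology Hausdorff_space_subtopology)

lemma torus_nonempty: "topspace (torus m) \<noteq> {}"
proof -
  have "(\<lambda>i\<in>{..<m}. 1) \<in> topspace (torus m)"
    unfolding torus_def by (auto simp: topspace_product_topology)
  then show ?thesis by blast
qed

lemma k_space_prod_torus:
  assumes "compact_space Y"
  shows "k_space (prod_topology Y (torus m))"
  using assms compact_space_torus[of m] by (simp add: compact_imp_k_space compact_space_prod_topology)

lemma k_space_prod_unit_interval:
  assumes "k_space X"
  shows "k_space (prod_topology (top_of_set {0..1::real}) X)"
  using assms
  by (intro k_space_prod_topology_left)
    (auto intro!: compact_imp_locally_compact_space simp: compact_space_subtopology Hausdorff_space_subtopology)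

lemma path_in_mapping_space_imp_homotopic:
  assumes X: "k_space X" "Hausdorff_space X"
    and p: "continuous_map (top_of_set {0..1::real}) (mapping_space X Y) p"
  shows "homotopic_with (\<lambda>_. True) X Y (p 0) (p 1)"
  unfolding homotopic_with_def
proof (intro exI conjI)
  show "continuous_map (prod_topology (top_of_set {0..1}) X) Y (\<lambda>(t, x). p t x)"
    by (rule continuous_map_uncurry[OF p X(2) k_space_prod_unit_interval[OF X(1)]])
qed auto

section \<open>Maps of a given order on the cylinder\<close>

abbreviation unit_interval :: "real topology" where
  "unit_interval \<equiv> top_of_set {0..1}"

lemma topspace_cylinder: "topspace (cylinder n) = {0..1} \<times> topspace (torus (n - 1))"
  by (simp add: cylinder_def)

lemma order_ends_cong:
  assumes "\<And>p. p \<in> topspace (cylinder n) \<Longrightarrow> f p = f' p"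
  shows "order_ends n z0 \<phi> g f \<longleftrightarrow> order_ends n z0 \<phi> g f'"
  using assms by (simp add: order_ends_def topspace_cylinder)

lemma of_order_iff_homotopic_self:
  "of_order n Z z0 \<phi> g f \<longleftrightarrow> homotopic_with (order_ends n z0 \<phi> g) (cylinder n) Z f f"
  by (simp add: of_order_def)

lemma of_order_if_homotopic:
  assumes "homotopic_with (order_ends n z0 \<phi> g) (cylinder n) Z f f'"
  shows "of_order n Z z0 \<phi> g f" "of_order n Z z0 \<phi> g f'"
  using homotopic_with_imp_continuous_maps[OF assms] homotopic_with_imp_property[OF assms]
  by (auto simp: of_order_def)

lemma order_class_eqI:
  assumes "homotopic_with (order_ends n z0 \<phi> g) (cylinder n) Z f f'"
  shows "order_class n Z z0 \<phi> g f = order_class n Z z0 \<phi> g f'"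
  unfolding order_class_def
  using homotopic_with_trans[OF assms] homotopic_with_trans[OF homotopic_with_symD[OF assms]] by blast

lemma order_class_eq_iff:
  assumes "of_order n Z z0 \<phi> g f'"
  shows "order_class n Z z0 \<phi> g f = order_class n Z z0 \<phi> g f'
    \<longleftrightarrow> homotopic_with (order_ends n z0 \<phi> g) (cylinder n) Z f f'"
proof
  assume "order_class n Z z0 \<phi> g f = order_class n Z z0 \<phi> g f'"
  moreover have "f' \<in> order_class n Z z0 \<phi> g f'"
    using assms by (simp add: order_class_def of_order_iff_homotopic_self)
  ultimately have "f' \<in> order_class n Z z0 \<phi> g f"
    by simp
  then show "homotopic_with (order_ends n z0 \<phi> g) (cylinder n) Z f f'"
    unfolding order_class_def mem_Collect_eq .
qed (rule order_class_eqI)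

lemma homotopic_of_order_equal:
  assumes "of_order n Z z0 \<phi> g f" and "\<And>p. p \<in> topspace (cylinder n) \<Longrightarrow> f p = f' p"
  shows "homotopic_with (order_ends n z0 \<phi> g) (cylinder n) Z f f'"
proof (rule homotopic_with_equal)
  show "order_ends n z0 \<phi> g f" "continuous_map (cylinder n) Z f"
    using assms(1) by (auto simp: of_order_def)
  then show "order_ends n z0 \<phi> g f'"
    by (simp add: order_ends_cong[OF assms(2)])
qed (rule assms(2))

text \<open>The operations on homotopy classes are unions over representatives. This rule evaluates such a
union on a chosen representative once the operation is known to respect homotopy.\<close>

lemma UN_order_class:
  assumes f: "of_order n Z z0 \<phi> g f"
    and F: "\<And>f'. homotopic_with (order_ends n z0 \<phi> g) (cylinder n) Z f f' \<Longrightarrow> F f' = F f"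
  shows "(\<Union>f'\<in>order_class n Z z0 \<phi> g f. F f') = F f"
proof -
  have "f \<in> order_class n Z z0 \<phi> g f"
    using f by (simp add: order_class_def of_order_iff_homotopic_self)
  moreover have "F f' = F f" if "f' \<in> order_class n Z z0 \<phi> g f" for f'
    using that F unfolding order_class_def by blast
  ultimately show ?thesis
    by blast
qed

lemma continuous_map_cyl_concat:
  assumes a: "continuous_map (prod_topology unit_interval S) Z a"
    and b: "continuous_map (prod_topology unit_interval S) Z b"
    and ab: "\<And>s. s \<in> topspace S \<Longrightarrow> a (1, s) = b (0, s)"
  shows "continuous_map (prod_topology unit_interval S) Z (cyl_concat a b)"
proof -
  let ?P = "prod_topology unit_interval S"
  have fst_cont: "continuous_map ?P euclideanreal fst"
    using continuous_map_fst[of unit_interval S] by (rule continuous_map_into_fulltopology)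
  have snd_cont: "continuous_map ?P S snd"
    by (rule continuous_map_snd)
  have cont: "continuous_map ?P Z (\<lambda>p. if fst p \<le> 1/2 then a (2 * fst p, snd p) else b (2 * fst p - 1, snd p))"
  proof (rule continuous_map_cases_le[OF fst_cont])
    show "continuous_map (subtopology ?P {x \<in> topspace ?P. fst x \<le> 1/2}) Z (\<lambda>p. a (2 * fst p, snd p))"
    proof -
      have "continuous_map (subtopology ?P {x \<in> topspace ?P. fst x \<le> 1/2}) ?P (\<lambda>p. (2 * fst p, snd p))"
        using fst_cont snd_cont
        by (auto simp: continuous_map_pairwise o_def continuous_map_in_subtopology
            intro!: continuous_map_real_mult continuous_map_from_subtopology)
      from continuous_map_compose[OF this a] show ?thesis
        by (simp add: o_def)
    qed
    show "continuous_map (subtopology ?P {x \<in> topspace ?P. 1/2 \<le> fst x}) Z (\<lambda>p. b (2 * fst p - 1, snd p))"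
    proof -
      have "continuous_map (subtopology ?P {x \<in> topspace ?P. 1/2 \<le> fst x}) ?P (\<lambda>p. (2 * fst p - 1, snd p))"
        using fst_cont snd_cont
        by (auto simp: continuous_map_pairwise o_def continuous_map_in_subtopology
            intro!: continuous_map_diff continuous_map_real_mult continuous_map_from_subtopology)
      from continuous_map_compose[OF this b] show ?thesis
        by (simp add: o_def)
    qed
    show "a (2 * fst p, snd p) = b (2 * fst p - 1, snd p)" if "p \<in> topspace ?P" "fst p = 1/2" for p
    proof -
      have "2 * fst p = 1" "2 * fst p - 1 = 0" using that(2) by simp_all
      then show ?thesis using that(1) ab[of "snd p"] by auto
    qed
  qed simp
  show ?thesis
    by (rule continuous_map_eq[OF cont]) (auto simp: cyl_concat_def)
qed

lemma continuous_map_swap_left: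
  assumes "continuous_map (prod_topology A (prod_topology B C)) Z h"
  shows "continuous_map (prod_topology B (prod_topology A C)) Z (\<lambda>(b, a, c). h (a, b, c))"
proof -
  have "continuous_map (prod_topology B (prod_topology A C)) (prod_topology A (prod_topology B C))
      (\<lambda>p. (fst (snd p), fst p, snd (snd p)))"
    by (auto simp: continuous_map_pairwise o_def
        intro: continuous_map_fst continuous_map_compose[OF continuous_map_snd continuous_map_fst, unfolded o_def]
          continuous_map_compose[OF continuous_map_snd continuous_map_snd, unfolded o_def])
  from continuous_map_compose[OF this assms] show ?thesis
    by (simp add: o_def case_prod_unfold)
qed

text \<open>Two reparametrizations of the interval that agree at both ends are joined by the straight-line
homotopy, which keeps the ends fixed. Unit, inverse and associativity laws all reduce to this.\<close>

lemma homotopic_reparametrization: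
  fixes \<alpha> \<beta> :: "real \<Rightarrow> real"
  assumes f: "continuous_map (cylinder n) Z f"
    and ends: "order_ends n z0 \<phi> g (\<lambda>(t, s). f (\<alpha> t, s))"
    and cont: "continuous_on {0..1} \<alpha>" "continuous_on {0..1} \<beta>"
    and im: "\<alpha> ` {0..1} \<subseteq> {0..1}" "\<beta> ` {0..1} \<subseteq> {0..1}"
    and eq: "\<alpha> 0 = \<beta> 0" "\<alpha> 1 = \<beta> 1"
  shows "homotopic_with (order_ends n z0 \<phi> g) (cylinder n) Z
    (\<lambda>(t, s). f (\<alpha> t, s)) (\<lambda>(t, s). f (\<beta> t, s))"
  unfolding homotopic_with_def
proof (intro exI conjI allI ballI)
  let ?m = "\<lambda>p. (1 - fst p) * \<alpha> (fst (snd p)) + fst p * \<beta> (fst (snd p))"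
  let ?h = "\<lambda>(u, t, s). f ((1 - u) * \<alpha> t + u * \<beta> t, s)"
  let ?P = "prod_topology unit_interval (cylinder n)"
  have 1: "continuous_map ?P euclideanreal fst"
    using continuous_map_fst[of unit_interval] by (rule continuous_map_into_fulltopology)
  have 2: "continuous_map ?P unit_interval (\<lambda>p. fst (snd p))"
    unfolding cylinder_def
    using continuous_map_compose[OF continuous_map_snd continuous_map_fst] by (simp add: o_def)
  have 3: "continuous_map ?P (torus (n - 1)) (\<lambda>p. snd (snd p))"
    unfolding cylinder_def
    using continuous_map_compose[OF continuous_map_snd continuous_map_snd] by (simp add: o_def)
  have \<alpha>: "continuous_map ?P euclideanreal (\<lambda>p. \<alpha> (fst (snd p)))"
    using continuous_map_compose[OF 2, of euclideanreal \<alpha>] cont(1) by (simp add: o_def)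
  have \<beta>: "continuous_map ?P euclideanreal (\<lambda>p. \<beta> (fst (snd p)))"
    using continuous_map_compose[OF 2, of euclideanreal \<beta>] cont(2) by (simp add: o_def)
  have m: "continuous_map ?P euclideanreal ?m"
    using 1 \<alpha> \<beta> by (intro continuous_intros) auto
  have m01: "?m p \<in> {0..1}" if "p \<in> topspace ?P" for p
  proof -
    have "\<alpha> (fst (snd p)) \<in> {0..1}" "\<beta> (fst (snd p)) \<in> {0..1}" "fst p \<in> {0..1}"
      using that im by (auto simp: topspace_cylinder)
    moreover have "convex {0..1::real}"
      by simp
    ultimately show ?thesis
      using convexD_alt[of "{0..1::real}" "\<alpha> (fst (snd p))" "\<beta> (fst (snd p))" "fst p"] by auto
  qed
  have "continuous_map ?P (cylinder n) (\<lambda>p. (?m p, snd (snd p)))"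
    using m 3 m01
    by (subst cylinder_def) (auto simp: continuous_map_pairwise o_def continuous_map_in_subtopology)
  from continuous_map_compose[OF this f]
  show "continuous_map ?P Z ?h"
    by (simp add: o_def case_prod_unfold)
  show "order_ends n z0 \<phi> g (\<lambda>x. ?h (u, x))" for u :: real
  proof -
    have "(1 - u) * \<alpha> 0 + u * \<beta> 0 = \<alpha> 0" "(1 - u) * \<alpha> 1 + u * \<beta> 1 = \<alpha> 1"
      using eq by (simp_all add: algebra_simps)
    then show ?thesis
      using ends by (simp add: order_ends_def)
  qed
qed auto

lemma homotopic_reparametrization_self:
  fixes \<alpha> :: "real \<Rightarrow> real"
  assumes f: "of_order n Z z0 \<phi> g f"
    and \<alpha>: "continuous_on {0..1} \<alpha>" "\<alpha> ` {0..1} \<subseteq> {0..1}" "\<alpha> 0 = 0" "\<alpha> 1 = 1"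
  shows "homotopic_with (order_ends n z0 \<phi> g) (cylinder n) Z (\<lambda>(t, s). f (\<alpha> t, s)) f"
proof -
  have "homotopic_with (order_ends n z0 \<phi> g) (cylinder n) Z
      (\<lambda>(t, s). f (\<alpha> t, s)) (\<lambda>(t, s). f (t, s))"
    by (rule homotopic_reparametrization[where \<beta> = "\<lambda>t. t"])
      (use f \<alpha> in \<open>auto simp: of_order_def order_ends_def\<close>)
  then show ?thesis
    by (simp only: case_prod_eta)
qed

section \<open>The Rhodes group of a pointed G-space\<close>

locale pointed_G_space = group G for G (structure) +
  fixes Z :: "'z topology" and z0 :: 'z and \<phi> :: "'g \<Rightarrow> 'z \<Rightarrow> 'z"
  assumes G_space: "G_space G Z \<phi>" and base: "z0 \<in> topspace Z"
begin

lemma action: "group_action G (topspace Z) \<phi>"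
  using G_space by (simp add: G_space_def)

lemma act_continuous: "g \<in> carrier G \<Longrightarrow> continuous_map Z Z (\<phi> g)"
  using G_space by (simp add: G_space_def)

lemma act_one: "z \<in> topspace Z \<Longrightarrow> \<phi> \<one> z = z"
  using group_action.id_eq_one[OF action] by (metis restrict_apply')

lemma act_mult:
  "g \<in> carrier G \<Longrightarrow> h \<in> carrier G \<Longrightarrow> z \<in> topspace Z \<Longrightarrow> \<phi> (g \<otimes> h) z = \<phi> g (\<phi> h z)"
  using group_action.composition_rule[OF action] by simp

lemma of_order_mem:
  "of_order n Z z0 \<phi> g f \<Longrightarrow> p \<in> topspace (cylinder n) \<Longrightarrow> f p \<in> topspace Z"
  by (auto simp: of_order_def continuous_map_def)

text \<open>The homotopies are concatenated in the cylinder coordinate, with the homotopy parameter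
carried along as an additional coordinate of the torus factor.\<close>

lemma homotopic_cyl_concat:
  assumes g: "g \<in> carrier G" and h: "h \<in> carrier G"
    and a: "homotopic_with (order_ends n z0 \<phi> g) (cylinder n) Z a a'"
    and b: "homotopic_with (order_ends n z0 \<phi> h) (cylinder n) Z b b'"
  shows "homotopic_with (order_ends n z0 \<phi> (g \<otimes> h)) (cylinder n) Z
    (cyl_concat a (\<phi> g \<circ> b)) (cyl_concat a' (\<phi> g \<circ> b'))"
proof -
  let ?I = unit_interval and ?T = "torus (n - 1)"
  from a obtain H where H: "continuous_map (prod_topology ?I (cylinder n)) Z H"
      "\<And>p. H (0, p) = a p" "\<And>p. H (1, p) = a' p"
      "\<And>u. u \<in> {0..1} \<Longrightarrow> order_ends n z0 \<phi> g (\<lambda>p. H (u, p))"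
    unfolding homotopic_with_def by blast
  from b obtain K where K: "continuous_map (prod_topology ?I (cylinder n)) Z K"
      "\<And>p. K (0, p) = b p" "\<And>p. K (1, p) = b' p"
      "\<And>u. u \<in> {0..1} \<Longrightarrow> order_ends n z0 \<phi> h (\<lambda>p. K (u, p))"
    unfolding homotopic_with_def by blast
  let ?H = "\<lambda>(t, u, s). H (u, t, s)" and ?K = "\<lambda>(t, u, s). (\<phi> g \<circ> K) (u, t, s)"
  have gK: "continuous_map (prod_topology ?I (cylinder n)) Z (\<phi> g \<circ> K)"
    by (rule continuous_map_compose[OF K(1) act_continuous[OF g]])
  have "continuous_map (prod_topology ?I (prod_topology ?I ?T)) Z (cyl_concat ?H ?K)"
  proof (rule continuous_map_cyl_concat)
    show "continuous_map (prod_topology ?I (prod_topology ?I ?T)) Z ?H"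
      using continuous_map_swap_left[OF H(1)[unfolded cylinder_def]] .
    show "continuous_map (prod_topology ?I (prod_topology ?I ?T)) Z ?K"
      using continuous_map_swap_left[OF gK[unfolded cylinder_def]] .
    show "?H (1, s) = ?K (0, s)" if "s \<in> topspace (prod_topology ?I ?T)" for s
      using that H(4)[of "fst s"] K(4)[of "fst s"] by (cases s) (simp add: order_ends_def)
  qed
  note L = continuous_map_swap_left[OF this]
  show ?thesis
    unfolding homotopic_with_def
  proof (intro exI conjI allI ballI)
    show "continuous_map (prod_topology ?I (cylinder n)) Z (\<lambda>(u, t, s). cyl_concat ?H ?K (t, u, s))"
      unfolding cylinder_def using L .
    fix u :: real assume "u \<in> {0..1}"
    then show "order_ends n z0 \<phi> (g \<otimes> h) (\<lambda>p. (\<lambda>(u, t, s). cyl_concat ?H ?K (t, u, s)) (u, p))"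
      using H(4)[of u] K(4)[of u] g h base by (simp add: order_ends_def cyl_concat_def act_mult)
  qed (auto simp: cyl_concat_def H K)
qed

lemma of_order_cyl_concat:
  assumes "g \<in> carrier G" "h \<in> carrier G" "of_order n Z z0 \<phi> g a" "of_order n Z z0 \<phi> h b"
  shows "of_order n Z z0 \<phi> (g \<otimes> h) (cyl_concat a (\<phi> g \<circ> b))"
  using homotopic_cyl_concat[OF assms(1,2) assms(3,4)[unfolded of_order_iff_homotopic_self]]
  by (simp only: of_order_iff_homotopic_self)

lemma of_order_const: "of_order n Z z0 \<phi> \<one> (\<lambda>_. z0)"
  using base by (simp add: of_order_def order_ends_def act_one)

lemma rhodes_group_carrier:
  "carrier (rhodes_group n Z z0 G \<phi>)
    = {(order_class n Z z0 \<phi> g f, g) | f g. g \<in> carrier G \<and> of_order n Z z0 \<phi> g f}"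
  by (simp add: rhodes_group_def)

lemma rhodes_group_one: "\<one>\<^bsub>rhodes_group n Z z0 G \<phi>\<^esub> = (order_class n Z z0 \<phi> \<one> (\<lambda>_. z0), \<one>)"
  by (simp add: rhodes_group_def)

lemma rhodes_group_mult:
  assumes g: "g \<in> carrier G" "h \<in> carrier G"
    and a: "of_order n Z z0 \<phi> g a" and b: "of_order n Z z0 \<phi> h b"
  shows "(order_class n Z z0 \<phi> g a, g) \<otimes>\<^bsub>rhodes_group n Z z0 G \<phi>\<^esub> (order_class n Z z0 \<phi> h b, h)
    = (order_class n Z z0 \<phi> (g \<otimes> h) (cyl_concat a (\<phi> g \<circ> b)), g \<otimes> h)"
proof -
  let ?c = "\<lambda>a b. order_class n Z z0 \<phi> (g \<otimes> h) (cyl_concat a (\<phi> g \<circ> b))"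
  have inner: "(\<Union>b'\<in>order_class n Z z0 \<phi> h b. ?c a' b') = ?c a' b" if "of_order n Z z0 \<phi> g a'" for a'
    using b
  proof (rule UN_order_class)
    fix b' assume "homotopic_with (order_ends n z0 \<phi> h) (cylinder n) Z b b'"
    then show "?c a' b' = ?c a' b"
      using that homotopic_cyl_concat[OF g]
      by (intro order_class_eqI[symmetric]) (simp add: of_order_iff_homotopic_self)
  qed
  have "(\<Union>a'\<in>order_class n Z z0 \<phi> g a. \<Union>b'\<in>order_class n Z z0 \<phi> h b. ?c a' b')
      = (\<Union>b'\<in>order_class n Z z0 \<phi> h b. ?c a b')"
    using a
  proof (rule UN_order_class)
    fix a' assume aa': "homotopic_with (order_ends n z0 \<phi> g) (cylinder n) Z a a'"
    then have "?c a' b = ?c a b"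
      using b homotopic_cyl_concat[OF g]
      by (intro order_class_eqI[symmetric]) (simp add: of_order_iff_homotopic_self)
    then show "(\<Union>b'\<in>order_class n Z z0 \<phi> h b. ?c a' b') = (\<Union>b'\<in>order_class n Z z0 \<phi> h b. ?c a b')"
      using inner[OF of_order_if_homotopic(2)[OF aa']] inner[OF a] by simp
  qed
  then show ?thesis
    using inner[OF a] by (simp add: rhodes_group_def)
qed

text \<open>The concatenation first waits at the base point and then runs through \<open>f\<close> at double speed, so
it is \<open>f\<close> reparametrized by \<open>max 0 (2 * t - 1)\<close>.\<close>

lemma homotopic_const_concat:
  assumes g: "g \<in> carrier G" and f: "of_order n Z z0 \<phi> g f"
  shows "homotopic_with (order_ends n z0 \<phi> g) (cylinder n) Z (cyl_concat (\<lambda>_. z0) (\<phi> \<one> \<circ> f)) f"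
proof -
  let ?\<alpha> = "\<lambda>t::real. max 0 (2 * t - 1)"
  have fc: "continuous_map (cylinder n) Z f" and fe: "order_ends n z0 \<phi> g f"
    using f by (auto simp: of_order_def)
  have 1: "homotopic_with (order_ends n z0 \<phi> g) (cylinder n) Z (\<lambda>(t, s). f (?\<alpha> t, s)) f"
    by (rule homotopic_reparametrization_self[OF f]) (auto intro!: continuous_intros)
  have "homotopic_with (order_ends n z0 \<phi> g) (cylinder n) Z
      (\<lambda>(t, s). f (?\<alpha> t, s)) (cyl_concat (\<lambda>_. z0) (\<phi> \<one> \<circ> f))"
    using of_order_if_homotopic(1)[OF 1]
  proof (rule homotopic_of_order_equal)
    fix p assume p: "p \<in> topspace (cylinder n)"
    obtain t s where ts: "p = (t, s)" "t \<in> {0..1}" "s \<in> topspace (torus (n - 1))"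
      using p by (auto simp: topspace_cylinder)
    show "(\<lambda>(t, s). f (?\<alpha> t, s)) p = cyl_concat (\<lambda>_. z0) (\<phi> \<one> \<circ> f) p"
    proof (cases "t \<le> 1/2")
      case True
      then have "?\<alpha> t = 0" by simp
      then show ?thesis using True ts fe by (simp add: cyl_concat_def order_ends_def)
    next
      case False
      then have "f (2 * t - 1, s) \<in> topspace Z"
        using ts by (intro of_order_mem[OF f]) (auto simp: topspace_cylinder)
      then show ?thesis using False ts by (simp add: cyl_concat_def act_one max_def)
    qed
  qed
  then show ?thesis
    using 1 by (rule homotopic_with_trans[OF homotopic_with_symD])
qed

text \<open>Reversing a map of order \<open>g\<close> gives a map from \<open>g z0\<close> to \<open>z0\<close>; translating by \<open>inv g\<close> turns it into
a map from \<open>z0\<close> to \<open>inv g z0\<close>, that is, of order \<open>inv g\<close>.\<close>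

lemma homotopic_inverse_concat:
  assumes g: "g \<in> carrier G" and f: "of_order n Z z0 \<phi> g f"
  defines "r \<equiv> (\<lambda>(t, s). \<phi> (inv g) (f (1 - t, s)))"
  shows "of_order n Z z0 \<phi> (inv g) r"
    and "homotopic_with (order_ends n z0 \<phi> \<one>) (cylinder n) Z
      (cyl_concat r (\<phi> (inv g) \<circ> f)) (\<lambda>_. z0)"
proof -
  let ?F = "\<phi> (inv g) \<circ> f" and ?T = "topspace (torus (n - 1))"
  have ig: "inv g \<in> carrier G"
    using g by simp
  have fc: "continuous_map (cylinder n) Z f" and fe: "order_ends n z0 \<phi> g f"
    using f by (auto simp: of_order_def)
  have Fc: "continuous_map (cylinder n) Z ?F"
    using continuous_map_compose[OF fc act_continuous[OF ig]] .
  have F0: "?F (0, s) = \<phi> (inv g) z0" and F1: "?F (1, s) = z0" if "s \<in> ?T" for s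
    using that fe act_mult[OF ig g base] act_one[OF base] g by (simp_all add: order_ends_def)
  have "homotopic_with (order_ends n z0 \<phi> (inv g)) (cylinder n) Z
      (\<lambda>(t, s). ?F (1 - t, s)) (\<lambda>(t, s). ?F (1 - t, s))"
    by (rule homotopic_reparametrization[OF Fc])
      (use F0 F1 in \<open>auto simp: order_ends_def intro!: continuous_intros\<close>)
  then show r: "of_order n Z z0 \<phi> (inv g) r"
    using of_order_if_homotopic(1) by (fastforce simp: r_def)
  have 1: "homotopic_with (order_ends n z0 \<phi> \<one>) (cylinder n) Z
      (\<lambda>(t, s). ?F (\<bar>1 - 2 * t\<bar>, s)) (\<lambda>(t, s). ?F (1, s))"
    by (rule homotopic_reparametrization[OF Fc, where \<beta> = "\<lambda>_. 1"])
      (use F1 base in \<open>auto simp: order_ends_def act_one intro!: continuous_intros\<close>)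
  \<comment> \<open>The concatenation runs from time 1 back to time 0 and forth again.\<close>
  have 2: "cyl_concat r ?F = (\<lambda>(t, s). ?F (\<bar>1 - 2 * t\<bar>, s))"
    by (auto simp: cyl_concat_def r_def fun_eq_iff)
  have "homotopic_with (order_ends n z0 \<phi> \<one>) (cylinder n) Z (\<lambda>(t, s). ?F (1, s)) (\<lambda>_. z0)"
    by (rule homotopic_of_order_equal[OF of_order_if_homotopic(2)[OF 1]])
      (use F1 in \<open>auto simp: topspace_cylinder\<close>)
  with 1 show "homotopic_with (order_ends n z0 \<phi> \<one>) (cylinder n) Z (cyl_concat r ?F) (\<lambda>_. z0)"
    unfolding 2 by (rule homotopic_with_trans)
qed

text \<open>The left bracketing spends the time intervals \<open>[0, 1/4]\<close>, \<open>[1/4, 1/2]\<close>, \<open>[1/2, 1]\<close> on the three maps,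
the right one \<open>[0, 1/2]\<close>, \<open>[1/2, 3/4]\<close>, \<open>[3/4, 1]\<close>. The translations agree because
\<open>\<phi> (g \<otimes> h) = \<phi> g \<circ> \<phi> h\<close> on \<open>Z\<close>.\<close>

lemma homotopic_concat_assoc:
  assumes g: "g \<in> carrier G" "h \<in> carrier G" "k \<in> carrier G"
    and a: "of_order n Z z0 \<phi> g a" and b: "of_order n Z z0 \<phi> h b" and c: "of_order n Z z0 \<phi> k c"
  shows "homotopic_with (order_ends n z0 \<phi> (g \<otimes> h \<otimes> k)) (cylinder n) Z
    (cyl_concat (cyl_concat a (\<phi> g \<circ> b)) (\<phi> (g \<otimes> h) \<circ> c))
    (cyl_concat a (\<phi> g \<circ> cyl_concat b (\<phi> h \<circ> c)))"
proof -
  let ?R = "cyl_concat a (\<phi> g \<circ> cyl_concat b (\<phi> h \<circ> c))"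
  let ?L = "cyl_concat (cyl_concat a (\<phi> g \<circ> b)) (\<phi> (g \<otimes> h) \<circ> c)"
  \<comment> \<open>The piecewise linear map with slopes 2, 1, 1/2 that sends 1/4 to 1/2 and 1/2 to 3/4; as the
    slopes decrease, it is the minimum of the three linear pieces.\<close>
  define \<alpha> :: "real \<Rightarrow> real" where "\<alpha> = (\<lambda>t. min (min (2 * t) (t + 1/4)) ((t + 1) / 2))"
  have R: "of_order n Z z0 \<phi> (g \<otimes> h \<otimes> k) ?R"
    using of_order_cyl_concat[OF g(1) _ a of_order_cyl_concat[OF g(2,3) b c]] g by (simp add: m_assoc)
  have 1: "homotopic_with (order_ends n z0 \<phi> (g \<otimes> h \<otimes> k)) (cylinder n) Z (\<lambda>(t, s). ?R (\<alpha> t, s)) ?R"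
  proof (rule homotopic_reparametrization_self[OF R])
    show "continuous_on {0..1} \<alpha>"
      unfolding \<alpha>_def by (intro continuous_on_min continuous_intros) auto
  qed (auto simp: \<alpha>_def min_le_iff_disj)
  have "homotopic_with (order_ends n z0 \<phi> (g \<otimes> h \<otimes> k)) (cylinder n) Z (\<lambda>(t, s). ?R (\<alpha> t, s)) ?L"
    using of_order_if_homotopic(1)[OF 1]
  proof (rule homotopic_of_order_equal)
    fix p assume p: "p \<in> topspace (cylinder n)"
    obtain t s where ts: "p = (t, s)" "t \<in> {0..1}" "s \<in> topspace (torus (n - 1))"
      using p by (auto simp: topspace_cylinder)
    have "?R (\<alpha> t, s) = ?L (t, s)"
    proof -
      consider "t \<le> 1/4" | "1/4 < t" "t \<le> 1/2" | "1/2 < t" by linarith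
      then show ?thesis
      proof cases
        case 1
        then have "\<alpha> t = 2 * t" by (simp add: \<alpha>_def)
        then show ?thesis using 1 by (simp add: cyl_concat_def)
      next
        case 2
        then have "\<alpha> t = t + 1/4" by (simp add: \<alpha>_def)
        then have "\<not> \<alpha> t \<le> 1/2" "2 * \<alpha> t - 1 \<le> 1/2" "2 * (2 * \<alpha> t - 1) = 2 * (2 * t) - 1"
          using 2 by simp_all
        then show ?thesis using 2 by (simp add: cyl_concat_def)
      next
        case 3
        then have "\<alpha> t = (t + 1) / 2" by (simp add: \<alpha>_def)
        then have "\<not> \<alpha> t \<le> 1/2" "\<not> 2 * \<alpha> t - 1 \<le> 1/2" "2 * (2 * \<alpha> t - 1) - 1 = 2 * t - 1"
          using 3 by (simp_all add: field_simps)
        then have "?R (\<alpha> t, s) = \<phi> g (\<phi> h (c (2 * t - 1, s)))"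
          by (simp only: cyl_concat_def prod.case comp_apply if_False)
        moreover have "c (2 * t - 1, s) \<in> topspace Z"
          using 3 ts by (intro of_order_mem[OF c]) (auto simp: topspace_cylinder)
        ultimately show ?thesis using 3 g by (simp add: cyl_concat_def act_mult)
      qed
    qed
    then show "(\<lambda>(t, s). ?R (\<alpha> t, s)) p = ?L p"
      by (simp only: ts(1) prod.case)
  qed
  then show ?thesis
    using 1 by (rule homotopic_with_trans[OF homotopic_with_symD])
qed

theorem group_rhodes_group: "group (rhodes_group n Z z0 G \<phi>)"
proof (rule groupI)
  let ?R = "rhodes_group n Z z0 G \<phi>"
  show "\<one>\<^bsub>?R\<^esub> \<in> carrier ?R"
    using of_order_const by (force simp: rhodes_group_one rhodes_group_carrier)
  fix x assume "x \<in> carrier ?R"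
  then obtain g a where x: "x = (order_class n Z z0 \<phi> g a, g)" "g \<in> carrier G" "of_order n Z z0 \<phi> g a"
    by (auto simp: rhodes_group_carrier)
  show "\<one>\<^bsub>?R\<^esub> \<otimes>\<^bsub>?R\<^esub> x = x"
    using x order_class_eqI[OF homotopic_const_concat[OF x(2,3)]]
    by (simp add: rhodes_group_one rhodes_group_mult[OF one_closed x(2) of_order_const x(3)])
  note inv = homotopic_inverse_concat[OF x(2,3)]
  show "\<exists>y\<in>carrier ?R. y \<otimes>\<^bsub>?R\<^esub> x = \<one>\<^bsub>?R\<^esub>"
  proof
    let ?y = "(order_class n Z z0 \<phi> (inv g) (\<lambda>(t, s). \<phi> (inv g) (a (1 - t, s))), inv g)"
    show "?y \<in> carrier ?R"
      using inv(1) x(2) by (auto simp: rhodes_group_carrier)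
    show "?y \<otimes>\<^bsub>?R\<^esub> x = \<one>\<^bsub>?R\<^esub>"
      using x order_class_eqI[OF inv(2)]
      by (simp add: rhodes_group_one rhodes_group_mult[OF inv_closed[OF x(2)] x(2) inv(1) x(3)])
  qed
  fix y assume "y \<in> carrier ?R"
  then obtain h b where y: "y = (order_class n Z z0 \<phi> h b, h)" "h \<in> carrier G" "of_order n Z z0 \<phi> h b"
    by (auto simp: rhodes_group_carrier)
  show "x \<otimes>\<^bsub>?R\<^esub> y \<in> carrier ?R"
    using x y of_order_cyl_concat[OF x(2) y(2) x(3) y(3)]
    by (auto simp: rhodes_group_mult rhodes_group_carrier)
  fix z assume "z \<in> carrier ?R"
  then obtain k c where z: "z = (order_class n Z z0 \<phi> k c, k)" "k \<in> carrier G" "of_order n Z z0 \<phi> k c"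
    by (auto simp: rhodes_group_carrier)
  show "x \<otimes>\<^bsub>?R\<^esub> y \<otimes>\<^bsub>?R\<^esub> z = x \<otimes>\<^bsub>?R\<^esub> (y \<otimes>\<^bsub>?R\<^esub> z)"
    using x y z order_class_eqI[OF homotopic_concat_assoc[OF x(2) y(2) z(2) x(3) y(3) z(3)]]
    by (simp add: rhodes_group_mult of_order_cyl_concat m_assoc)
qed

lemma group_hom_rhodes_proj: "group_hom (rhodes_group n Z z0 G \<phi>) G rhodes_proj"
  by (intro group_hom.intro group_hom_axioms.intro group_rhodes_group is_group)
    (auto simp: hom_def rhodes_group_def rhodes_proj_def)

end

section \<open>Functoriality of the Rhodes group\<close>

locale pointed_G_map =
  Z: pointed_G_space G Z z0 \<phi> + W: pointed_G_space G W w0 \<psi>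
  for G (structure) and Z :: "'z topology" and z0 \<phi> and W :: "'w topology" and w0 \<psi> +
  fixes h :: "'z \<Rightarrow> 'w"
  assumes continuous: "continuous_map Z W h" and preserves_base: "h z0 = w0"
    and equivariant: "\<And>g z. g \<in> carrier G \<Longrightarrow> z \<in> topspace Z \<Longrightarrow> h (\<phi> g z) = \<psi> g (h z)"
begin

lemma order_ends_comp:
  assumes "g \<in> carrier G" "order_ends n z0 \<phi> g f"
  shows "order_ends n w0 \<psi> g (h \<circ> f)"
  using assms equivariant[OF assms(1) Z.base] preserves_base by (simp add: order_ends_def)

lemma homotopic_comp:
  assumes "g \<in> carrier G" "homotopic_with (order_ends n z0 \<phi> g) (cylinder n) Z f f'"
  shows "homotopic_with (order_ends n w0 \<psi> g) (cylinder n) W (h \<circ> f) (h \<circ> f')"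
  using assms(2) continuous order_ends_comp[OF assms(1)]
  by (rule homotopic_with_compose_continuous_map_left)

lemma of_order_comp:
  assumes "g \<in> carrier G" "of_order n Z z0 \<phi> g f"
  shows "of_order n W w0 \<psi> g (h \<circ> f)"
  using homotopic_comp[OF assms(1) assms(2)[unfolded of_order_iff_homotopic_self]]
  by (simp only: of_order_iff_homotopic_self)

lemma rhodes_induced_class:
  assumes g: "g \<in> carrier G" and f: "of_order n Z z0 \<phi> g f"
  shows "rhodes_induced n W w0 \<psi> h (order_class n Z z0 \<phi> g f, g) = (order_class n W w0 \<psi> g (h \<circ> f), g)"
proof -
  have "(\<Union>f'\<in>order_class n Z z0 \<phi> g f. order_class n W w0 \<psi> g (h \<circ> f')) = order_class n W w0 \<psi> g (h \<circ> f)"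
    using f
  proof (rule UN_order_class)
    fix f' assume "homotopic_with (order_ends n z0 \<phi> g) (cylinder n) Z f f'"
    from order_class_eqI[OF homotopic_comp[OF g this]]
    show "order_class n W w0 \<psi> g (h \<circ> f') = order_class n W w0 \<psi> g (h \<circ> f)" ..
  qed
  then show ?thesis
    by (simp add: rhodes_induced_def)
qed

lemma group_hom_rhodes_induced:
  "group_hom (rhodes_group n Z z0 G \<phi>) (rhodes_group n W w0 G \<psi>) (rhodes_induced n W w0 \<psi> h)"
proof (intro group_hom.intro group_hom_axioms.intro Z.group_rhodes_group W.group_rhodes_group homI)
  fix x assume "x \<in> carrier (rhodes_group n Z z0 G \<phi>)"
  then obtain g a where x: "x = (order_class n Z z0 \<phi> g a, g)" "g \<in> carrier G" "of_order n Z z0 \<phi> g a"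
    by (auto simp: Z.rhodes_group_carrier)
  have ha: "of_order n W w0 \<psi> g (h \<circ> a)"
    using of_order_comp[OF x(2,3)] .
  show "rhodes_induced n W w0 \<psi> h x \<in> carrier (rhodes_group n W w0 G \<psi>)"
    using x ha by (auto simp: rhodes_induced_class W.rhodes_group_carrier)
  fix y assume "y \<in> carrier (rhodes_group n Z z0 G \<phi>)"
  then obtain k b where y: "y = (order_class n Z z0 \<phi> k b, k)" "k \<in> carrier G" "of_order n Z z0 \<phi> k b"
    by (auto simp: Z.rhodes_group_carrier)
  have hb: "of_order n W w0 \<psi> k (h \<circ> b)"
    using of_order_comp[OF y(2,3)] .
  have gk: "g \<otimes> k \<in> carrier G"
    using x y by simp
  have ab: "of_order n Z z0 \<phi> (g \<otimes> k) (cyl_concat a (\<phi> g \<circ> b))"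
    by (rule Z.of_order_cyl_concat[OF x(2) y(2) x(3) y(3)])
  have "homotopic_with (order_ends n w0 \<psi> (g \<otimes> k)) (cylinder n) W
      (h \<circ> cyl_concat a (\<phi> g \<circ> b)) (cyl_concat (h \<circ> a) (\<psi> g \<circ> (h \<circ> b)))"
    using of_order_comp[OF gk ab]
  proof (rule homotopic_of_order_equal)
    fix p assume p: "p \<in> topspace (cylinder n)"
    obtain t s where ts: "p = (t, s)" "t \<in> {0..1}" "s \<in> topspace (torus (n - 1))"
      using p by (auto simp: topspace_cylinder)
    have "b (2 * t - 1, s) \<in> topspace Z" if "\<not> t \<le> 1/2"
      using ts that by (intro Z.of_order_mem[OF y(3)]) (auto simp: topspace_cylinder)
    then show "(h \<circ> cyl_concat a (\<phi> g \<circ> b)) p = cyl_concat (h \<circ> a) (\<psi> g \<circ> (h \<circ> b)) p"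
      using ts(1) x(2) by (simp add: cyl_concat_def equivariant)
  qed
  note eq = order_class_eqI[OF this]
  show "rhodes_induced n W w0 \<psi> h (x \<otimes>\<^bsub>rhodes_group n Z z0 G \<phi>\<^esub> y)
    = rhodes_induced n W w0 \<psi> h x \<otimes>\<^bsub>rhodes_group n W w0 G \<psi>\<^esub> rhodes_induced n W w0 \<psi> h y"
    unfolding x(1) y(1) Z.rhodes_group_mult[OF x(2) y(2) x(3) y(3)]
      rhodes_induced_class[OF gk ab] rhodes_induced_class[OF x(2,3)] rhodes_induced_class[OF y(2,3)]
      W.rhodes_group_mult[OF x(2) y(2) ha hb] eq ..
qed

lemma rhodes_induced_snd: "snd (rhodes_induced n W w0 \<psi> h x) = snd x"
  by (cases x) (simp add: rhodes_induced_def)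

end

section \<open>The Fox group as the kernel of the projection\<close>

lemma loop_class_eqI:
  assumes "homotopic_with (\<lambda>h. h 0 = z0 \<and> h 1 = z0) unit_interval Z f f'"
  shows "loop_class Z z0 f = loop_class Z z0 f'"
  unfolding loop_class_def
  using homotopic_with_trans[OF assms] homotopic_with_trans[OF homotopic_with_symD[OF assms]] by blast

lemma is_loop_iff_homotopic_self:
  "is_loop Z z0 f \<longleftrightarrow> homotopic_with (\<lambda>h. h 0 = z0 \<and> h 1 = z0) unit_interval Z f f"
  by (simp add: is_loop_def pathin_def)

lemma is_loop_if_homotopic:
  assumes "homotopic_with (\<lambda>h. h 0 = z0 \<and> h 1 = z0) unit_interval Z f f'"
  shows "is_loop Z z0 f'"
  using homotopic_with_imp_continuous_maps[OF assms] homotopic_with_imp_property[OF assms]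
  by (auto simp: is_loop_def pathin_def)

lemma loop_class_eq_iff:
  assumes "is_loop Z z0 f'"
  shows "loop_class Z z0 f = loop_class Z z0 f'
    \<longleftrightarrow> homotopic_with (\<lambda>h. h 0 = z0 \<and> h 1 = z0) unit_interval Z f f'"
proof
  assume "loop_class Z z0 f = loop_class Z z0 f'"
  moreover have "f' \<in> loop_class Z z0 f'"
    using assms by (simp add: loop_class_def is_loop_iff_homotopic_self)
  ultimately have "f' \<in> loop_class Z z0 f"
    by simp
  then show "homotopic_with (\<lambda>h. h 0 = z0 \<and> h 1 = z0) unit_interval Z f f'"
    unfolding loop_class_def mem_Collect_eq .
qed (rule loop_class_eqI)

lemma UN_loop_class:
  assumes f: "is_loop Z z0 f"
    and F: "\<And>f'. homotopic_with (\<lambda>h. h 0 = z0 \<and> h 1 = z0) unit_interval Z f f' \<Longrightarrow> F f' = F f"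
  shows "(\<Union>f'\<in>loop_class Z z0 f. F f') = F f"
proof -
  have "f \<in> loop_class Z z0 f"
    using f by (simp add: loop_class_def is_loop_iff_homotopic_self)
  moreover have "F f' = F f" if "f' \<in> loop_class Z z0 f" for f'
    using that F unfolding loop_class_def by blast
  ultimately show ?thesis
    by blast
qed

lemma continuous_map_assoc_right:
  assumes "continuous_map (prod_topology (prod_topology A B) C) Z h"
  shows "continuous_map (prod_topology A (prod_topology B C)) Z (\<lambda>(a, b, c). h ((a, b), c))"
proof -
  have "continuous_map (prod_topology A (prod_topology B C)) (prod_topology (prod_topology A B) C)
      (\<lambda>p. ((fst p, fst (snd p)), snd (snd p)))"
    by (auto simp: continuous_map_pairwise o_def
        intro: continuous_map_fst continuous_map_compose[OF continuous_map_snd continuous_map_fst, unfolded o_def]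
          continuous_map_compose[OF continuous_map_snd continuous_map_snd, unfolded o_def])
  from continuous_map_compose[OF this assms] show ?thesis
    by (simp add: o_def case_prod_unfold)
qed

lemma continuous_map_assoc_left:
  assumes "continuous_map (prod_topology A (prod_topology B C)) Z h"
  shows "continuous_map (prod_topology (prod_topology A B) C) Z (\<lambda>(y, c). h (fst y, snd y, c))"
proof -
  have "continuous_map (prod_topology (prod_topology A B) C) (prod_topology A (prod_topology B C))
      (\<lambda>p. (fst (fst p), snd (fst p), snd p))"
    by (auto simp: continuous_map_pairwise o_def
        intro: continuous_map_snd continuous_map_compose[OF continuous_map_fst continuous_map_fst, unfolded o_def]
          continuous_map_compose[OF continuous_map_fst continuous_map_snd, unfolded o_def])
  from continuous_map_compose[OF this assms] show ?thesis
    by (simp add: o_def case_prod_unfold)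
qed

lemma compact_space_unit_interval: "compact_space unit_interval"
  by (simp add: compact_space_subtopology)

text \<open>Transports the group laws along an injection whose image is a subgroup, without assuming
beforehand that the source is a group.\<close>

lemma group_if_embeds:
  fixes F :: "('a, 'r) monoid_scheme" and H :: "('b, 's) monoid_scheme"
  assumes H: "group H" and im: "subgroup (i ` carrier F) H" and inj: "inj_on i (carrier F)"
    and closed: "\<And>x y. x \<in> carrier F \<Longrightarrow> y \<in> carrier F \<Longrightarrow> x \<otimes>\<^bsub>F\<^esub> y \<in> carrier F"
    and mult: "\<And>x y. x \<in> carrier F \<Longrightarrow> y \<in> carrier F \<Longrightarrow> i (x \<otimes>\<^bsub>F\<^esub> y) = i x \<otimes>\<^bsub>H\<^esub> i y"
    and one: "\<one>\<^bsub>F\<^esub> \<in> carrier F" "i \<one>\<^bsub>F\<^esub> = \<one>\<^bsub>H\<^esub>"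
  shows "group F"
proof (rule groupI)
  interpret H: group H by fact
  have iH: "i x \<in> carrier H" if "x \<in> carrier F" for x
    using subgroup.subset[OF im] that by blast
  fix x assume x: "x \<in> carrier F"
  show "\<one>\<^bsub>F\<^esub> \<otimes>\<^bsub>F\<^esub> x = x"
    using x iH one by (intro inj_onD[OF inj]) (simp_all add: closed mult)
  have "inv\<^bsub>H\<^esub> (i x) \<in> i ` carrier F"
    using x subgroup.m_inv_closed[OF im] by blast
  then obtain y where y: "y \<in> carrier F" "i y = inv\<^bsub>H\<^esub> (i x)"
    by auto
  show "\<exists>y\<in>carrier F. y \<otimes>\<^bsub>F\<^esub> x = \<one>\<^bsub>F\<^esub>"
    using x y iH one by (intro bexI[of _ y] inj_onD[OF inj]) (simp_all add: closed mult)
  fix y z assume "y \<in> carrier F" "z \<in> carrier F"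
  then show "x \<otimes>\<^bsub>F\<^esub> y \<otimes>\<^bsub>F\<^esub> z = x \<otimes>\<^bsub>F\<^esub> (y \<otimes>\<^bsub>F\<^esub> z)"
    using x iH by (intro inj_onD[OF inj]) (simp_all add: closed mult H.m_assoc)
qed (use closed one in auto)

definition torus_loop :: "nat \<Rightarrow> 'z topology \<Rightarrow> 'z \<Rightarrow> (real \<Rightarrow> (nat \<Rightarrow> complex) \<Rightarrow> 'z) \<Rightarrow> bool" where
  "torus_loop n Z z0 f \<longleftrightarrow> is_loop (mapping_space (torus (n - 1)) Z) (const_map n z0) f"

context pointed_G_space
begin

text \<open>The exponential law for the torus. The extensionality condition only concerns the
representation of points of the mapping space.\<close>

lemma torus_loop_iff_of_order:
  "torus_loop n Z z0 f \<longleftrightarrow>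
    (\<forall>t\<in>{0..1}. f t \<in> extensional (topspace (torus (n - 1)))) \<and> of_order n Z z0 \<phi> \<one> (case_prod f)"
  (is "?loop \<longleftrightarrow> ?ext \<and> ?ord")
proof
  let ?T = "torus (n - 1)"
  assume ?loop
  then have f: "continuous_map unit_interval (mapping_space ?T Z) f" "f 0 = const_map n z0" "f 1 = const_map n z0"
    by (auto simp: torus_loop_def is_loop_def pathin_def)
  have "continuous_map (cylinder n) Z (case_prod f)"
    using continuous_map_uncurry[OF f(1) Hausdorff_space_torus k_space_prod_torus[OF compact_space_unit_interval]]
    by (simp add: cylinder_def)
  moreover have "order_ends n z0 \<phi> \<one> (case_prod f)"
    using f(2,3) base by (simp add: order_ends_def const_map_def act_one)
  moreover have ?ext
    using f(1) by (auto simp: continuous_map_def topspace_mapping_space)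
  ultimately show "?ext \<and> ?ord"
    by (simp add: of_order_def)
next
  let ?T = "torus (n - 1)"
  assume *: "?ext \<and> ?ord"
  then have ext: "?ext" and cont: "continuous_map (cylinder n) Z (case_prod f)"
    and ends: "order_ends n z0 \<phi> \<one> (case_prod f)"
    by (auto simp: of_order_def)
  have "continuous_map unit_interval (mapping_space ?T Z) (\<lambda>t. \<lambda>s\<in>topspace ?T. case_prod f (t, s))"
    using cont unfolding cylinder_def by (rule continuous_map_curry)
  then have "continuous_map unit_interval (mapping_space ?T Z) f"
    by (rule continuous_map_eq) (use ext in \<open>auto simp: extensional_restrict\<close>)
  moreover have "f t = const_map n z0" if "t \<in> {0, 1}" for t
    unfolding const_map_def
    by (rule extensionalityI[where A = "topspace ?T"])
      (use that ext ends base in \<open>auto simp: order_ends_def act_one\<close>)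
  ultimately show ?loop
    by (simp add: torus_loop_def is_loop_def pathin_def)
qed

text \<open>The exponential law again, now with the square of the interval as the parameter space.\<close>

lemma loop_homotopic_iff:
  assumes f: "torus_loop n Z z0 f"
    and f': "torus_loop n Z z0 f'"
  shows "homotopic_with (\<lambda>h. h 0 = const_map n z0 \<and> h 1 = const_map n z0) unit_interval
      (mapping_space (torus (n - 1)) Z) f f' \<longleftrightarrow>
    homotopic_with (order_ends n z0 \<phi> \<one>) (cylinder n) Z (case_prod f) (case_prod f')"
    (is "?loops \<longleftrightarrow> ?maps")
proof
  let ?T = "torus (n - 1)" and ?I = unit_interval
  assume ?loops
  then obtain H where H: "continuous_map (prod_topology ?I ?I) (mapping_space ?T Z) H"
      "\<And>t. H (0, t) = f t" "\<And>t. H (1, t) = f' t"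
      "\<And>u. u \<in> {0..1} \<Longrightarrow> H (u, 0) = const_map n z0 \<and> H (u, 1) = const_map n z0"
    unfolding homotopic_with_def by blast
  have "compact_space (prod_topology ?I ?I)"
    unfolding compact_space_prod_topology using compact_space_unit_interval by blast
  from continuous_map_assoc_right[OF continuous_map_uncurry[OF H(1) Hausdorff_space_torus k_space_prod_torus[OF this]]]
  have K: "continuous_map (prod_topology ?I (cylinder n)) Z (\<lambda>(u, t, s). H (u, t) s)"
    by (simp add: cylinder_def)
  show ?maps
    unfolding homotopic_with_def
  proof (intro exI conjI allI ballI)
    show "continuous_map (prod_topology ?I (cylinder n)) Z (\<lambda>(u, t, s). H (u, t) s)"
      by (rule K)
    fix u :: real assume "u \<in> {0..1}"
    then show "order_ends n z0 \<phi> \<one> (\<lambda>p. (\<lambda>(u, t, s). H (u, t) s) (u, p))"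
      using H(4)[of u] base by (simp add: order_ends_def const_map_def act_one)
  qed (auto simp: H)
next
  let ?T = "torus (n - 1)" and ?I = unit_interval
  assume ?maps
  then obtain K where K: "continuous_map (prod_topology ?I (cylinder n)) Z K"
      "\<And>p. K (0, p) = case_prod f p" "\<And>p. K (1, p) = case_prod f' p"
      "\<And>u. u \<in> {0..1} \<Longrightarrow> order_ends n z0 \<phi> \<one> (\<lambda>p. K (u, p))"
    unfolding homotopic_with_def by blast
  let ?H = "\<lambda>y. \<lambda>s\<in>topspace ?T. K (fst y, snd y, s)"
  have H: "continuous_map (prod_topology ?I ?I) (mapping_space ?T Z) ?H"
    using continuous_map_curry[OF continuous_map_assoc_left[OF K(1)[unfolded cylinder_def]]]
    by (simp only: prod.case)
  have ext: "f t \<in> extensional (topspace ?T)" "f' t \<in> extensional (topspace ?T)" if "t \<in> {0..1}" for t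
    using f f' that by (auto simp: torus_loop_iff_of_order)
  show ?loops
  proof (subst homotopic_with)
    show "\<exists>h. continuous_map (prod_topology ?I ?I) (mapping_space ?T Z) h \<and>
        (\<forall>t\<in>topspace ?I. h (0, t) = f t) \<and> (\<forall>t\<in>topspace ?I. h (1, t) = f' t) \<and>
        (\<forall>u\<in>{0..1}. h (u, 0) = const_map n z0 \<and> h (u, 1) = const_map n z0)"
    proof (intro exI conjI ballI)
      show "continuous_map (prod_topology ?I ?I) (mapping_space ?T Z) ?H"
        by (rule H)
    next
      fix u :: real assume "u \<in> {0..1}"
      with K(4)[of u] base show "?H (u, 0) = const_map n z0" "?H (u, 1) = const_map n z0"
        by (auto simp: order_ends_def const_map_def act_one intro!: restrict_ext)
    qed (use ext in \<open>auto simp: K extensional_restrict\<close>)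
  qed auto
qed

lemma fox_group_carrier:
  "carrier (fox_group n Z z0)
    = {fox_class n Z z0 f | f. torus_loop n Z z0 f}"
  by (simp add: fox_group_def fundamental_group_def fox_class_def torus_loop_def)

lemma fox_class_eq_iff:
  assumes "torus_loop n Z z0 f"
    and "torus_loop n Z z0 f'"
  shows "fox_class n Z z0 f = fox_class n Z z0 f'
    \<longleftrightarrow> homotopic_with (order_ends n z0 \<phi> \<one>) (cylinder n) Z (case_prod f) (case_prod f')"
  unfolding fox_class_def loop_class_eq_iff[OF assms(2)[unfolded torus_loop_def]] loop_homotopic_iff[OF assms] ..

lemma UN_fox_class:
  assumes f: "torus_loop n Z z0 f"
    and F: "\<And>f'. torus_loop n Z z0 f' \<Longrightarrow>
      homotopic_with (order_ends n z0 \<phi> \<one>) (cylinder n) Z (case_prod f) (case_prod f') \<Longrightarrow> F f' = F f"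
  shows "(\<Union>f'\<in>fox_class n Z z0 f. F f') = F f"
  unfolding fox_class_def using f[unfolded torus_loop_def]
proof (rule UN_loop_class)
  fix f' assume hom: "homotopic_with (\<lambda>h. h 0 = const_map n z0 \<and> h 1 = const_map n z0) unit_interval
      (mapping_space (torus (n - 1)) Z) f f'"
  have "torus_loop n Z z0 f'"
    unfolding torus_loop_def by (rule is_loop_if_homotopic[OF hom])
  with hom show "F f' = F f"
    using F loop_homotopic_iff[OF f] by blast
qed

lemma fox_to_rhodes_class:
  assumes "torus_loop n Z z0 f"
  shows "fox_to_rhodes n Z z0 G \<phi> (fox_class n Z z0 f) = (order_class n Z z0 \<phi> \<one> (case_prod f), \<one>)"
proof -
  have "(\<Union>f'\<in>fox_class n Z z0 f. order_class n Z z0 \<phi> \<one> (case_prod f'))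
      = order_class n Z z0 \<phi> \<one> (case_prod f)"
    by (rule UN_fox_class[OF assms]) (rule order_class_eqI[symmetric])
  then show ?thesis
    by (simp add: fox_to_rhodes_def)
qed

lemma loop_of_order_one_map:
  assumes F: "of_order n Z z0 \<phi> \<one> F"
  obtains f where "torus_loop n Z z0 f"
    "order_class n Z z0 \<phi> \<one> (case_prod f) = order_class n Z z0 \<phi> \<one> F"
proof
  let ?f = "\<lambda>t. \<lambda>s\<in>topspace (torus (n - 1)). F (t, s)"
  have hom: "homotopic_with (order_ends n z0 \<phi> \<one>) (cylinder n) Z F (case_prod ?f)"
    using F by (rule homotopic_of_order_equal) (auto simp: topspace_cylinder)
  from order_class_eqI[OF this] show "order_class n Z z0 \<phi> \<one> (case_prod ?f) = order_class n Z z0 \<phi> \<one> F" ..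
  show "torus_loop n Z z0 ?f"
    unfolding torus_loop_iff_of_order using of_order_if_homotopic(2)[OF hom] by auto
qed

lemma homotopic_cyl_concat_order_one:
  assumes a: "of_order n Z z0 \<phi> \<one> a" and b: "of_order n Z z0 \<phi> \<one> b"
  shows "homotopic_with (order_ends n z0 \<phi> \<one>) (cylinder n) Z (cyl_concat a (\<phi> \<one> \<circ> b)) (cyl_concat a b)"
proof (rule homotopic_of_order_equal)
  show "of_order n Z z0 \<phi> \<one> (cyl_concat a (\<phi> \<one> \<circ> b))"
    using of_order_cyl_concat[OF one_closed one_closed a b] by simp
  fix p assume p: "p \<in> topspace (cylinder n)"
  obtain t s where ts: "p = (t, s)" "t \<in> {0..1}" "s \<in> topspace (torus (n - 1))"
    using p by (auto simp: topspace_cylinder)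
  have "b (2 * t - 1, s) \<in> topspace Z" if "\<not> t \<le> 1/2"
    using ts that by (intro of_order_mem[OF b]) (auto simp: topspace_cylinder)
  then show "cyl_concat a (\<phi> \<one> \<circ> b) p = cyl_concat a b p"
    using ts(1) by (simp add: cyl_concat_def act_one)
qed

lemma case_prod_loop_concat: "case_prod (loop_concat a b) = cyl_concat (case_prod a) (case_prod b)"
  by (auto simp: loop_concat_def cyl_concat_def fun_eq_iff)

lemma torus_loop_concat:
  assumes a: "torus_loop n Z z0 a"
    and b: "torus_loop n Z z0 b"
  shows "torus_loop n Z z0 (loop_concat a b)"
proof -
  have "of_order n Z z0 \<phi> \<one> (case_prod (loop_concat a b))"
    using a b of_order_if_homotopic(2)[OF homotopic_cyl_concat_order_one]
    unfolding case_prod_loop_concat torus_loop_iff_of_order by blast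
  moreover have "loop_concat a b t \<in> extensional (topspace (torus (n - 1)))" if "t \<in> {0..1}" for t
    using a b that unfolding torus_loop_iff_of_order by (auto simp: loop_concat_def)
  ultimately show ?thesis
    unfolding torus_loop_iff_of_order by blast
qed

lemma fox_group_mult:
  assumes a: "torus_loop n Z z0 a"
    and b: "torus_loop n Z z0 b"
  shows "fox_class n Z z0 a \<otimes>\<^bsub>fox_group n Z z0\<^esub> fox_class n Z z0 b = fox_class n Z z0 (loop_concat a b)"
proof -
  have ord: "of_order n Z z0 \<phi> \<one> (case_prod f)"
    if "torus_loop n Z z0 f" for f
    using that by (simp add: torus_loop_iff_of_order)
  have concat: "fox_class n Z z0 (loop_concat a' b') = fox_class n Z z0 (loop_concat a b)"
    if a': "torus_loop n Z z0 a'"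
        "homotopic_with (order_ends n z0 \<phi> \<one>) (cylinder n) Z (case_prod a) (case_prod a')"
      and b': "torus_loop n Z z0 b'"
        "homotopic_with (order_ends n z0 \<phi> \<one>) (cylinder n) Z (case_prod b) (case_prod b')" for a' b'
  proof -
    have "homotopic_with (order_ends n z0 \<phi> \<one>) (cylinder n) Z
        (cyl_concat (case_prod a) (\<phi> \<one> \<circ> case_prod b)) (cyl_concat (case_prod a') (\<phi> \<one> \<circ> case_prod b'))"
      using homotopic_cyl_concat[OF one_closed one_closed a'(2) b'(2)] by simp
    then have "homotopic_with (order_ends n z0 \<phi> \<one>) (cylinder n) Z
        (cyl_concat (case_prod a) (case_prod b)) (cyl_concat (case_prod a') (case_prod b'))"
      using homotopic_cyl_concat_order_one[OF ord[OF a] ord[OF b]] homotopic_cyl_concat_order_one[OF ord[OF a'(1)] ord[OF b'(1)]]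
      by (meson homotopic_with_trans homotopic_with_symD)
    then show ?thesis
      unfolding fox_class_eq_iff[OF torus_loop_concat[OF a'(1) b'(1)] torus_loop_concat[OF a b]] case_prod_loop_concat
      by (rule homotopic_with_symD)
  qed
  have refl: "homotopic_with (order_ends n z0 \<phi> \<one>) (cylinder n) Z (case_prod f) (case_prod f)"
    if "torus_loop n Z z0 f" for f
    using ord[OF that] by (simp only: of_order_iff_homotopic_self)
  have "(\<Union>a'\<in>fox_class n Z z0 a. \<Union>b'\<in>fox_class n Z z0 b. fox_class n Z z0 (loop_concat a' b'))
      = (\<Union>b'\<in>fox_class n Z z0 b. fox_class n Z z0 (loop_concat a b'))"
  proof (rule UN_fox_class[OF a])
    fix a' assume a': "torus_loop n Z z0 a'"
        "homotopic_with (order_ends n z0 \<phi> \<one>) (cylinder n) Z (case_prod a) (case_prod a')"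
    have "(\<Union>b'\<in>fox_class n Z z0 b. fox_class n Z z0 (loop_concat a' b')) = fox_class n Z z0 (loop_concat a' b)"
      by (rule UN_fox_class[OF b]) (simp add: concat[OF a'] concat[OF a' b refl[OF b]])
    moreover have "(\<Union>b'\<in>fox_class n Z z0 b. fox_class n Z z0 (loop_concat a b')) = fox_class n Z z0 (loop_concat a b)"
      by (rule UN_fox_class[OF b]) (simp add: concat[OF a refl[OF a]])
    ultimately show "(\<Union>b'\<in>fox_class n Z z0 b. fox_class n Z z0 (loop_concat a' b'))
        = (\<Union>b'\<in>fox_class n Z z0 b. fox_class n Z z0 (loop_concat a b'))"
      using concat[OF a' b refl[OF b]] by simp
  qed
  also have "\<dots> = fox_class n Z z0 (loop_concat a b)"
    by (rule UN_fox_class[OF b]) (simp add: concat[OF a refl[OF a]])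
  finally show ?thesis
    by (simp add: fox_group_def fundamental_group_def fox_class_def)
qed

lemma torus_loop_const: "torus_loop n Z z0 (\<lambda>_. const_map n z0)"
  using base by (simp add: torus_loop_def is_loop_def pathin_def topspace_mapping_space const_map_def)

lemma fox_group_one: "\<one>\<^bsub>fox_group n Z z0\<^esub> = fox_class n Z z0 (\<lambda>_. const_map n z0)"
  by (simp add: fox_group_def fundamental_group_def fox_class_def)

lemma fox_to_rhodes_one: "fox_to_rhodes n Z z0 G \<phi> \<one>\<^bsub>fox_group n Z z0\<^esub> = \<one>\<^bsub>rhodes_group n Z z0 G \<phi>\<^esub>"
proof -
  have "of_order n Z z0 \<phi> \<one> (\<lambda>(t, s). const_map n z0 s)"
    using torus_loop_const[of n] by (simp add: torus_loop_iff_of_order)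
  then have "homotopic_with (order_ends n z0 \<phi> \<one>) (cylinder n) Z (\<lambda>(t, s). const_map n z0 s) (\<lambda>_. z0)"
    by (rule homotopic_of_order_equal) (auto simp: topspace_cylinder const_map_def)
  then show ?thesis
    unfolding fox_group_one fox_to_rhodes_class[OF torus_loop_const] rhodes_group_one
    by (simp add: order_class_eqI)
qed

lemma fox_to_rhodes_mult:
  assumes "x \<in> carrier (fox_group n Z z0)" "y \<in> carrier (fox_group n Z z0)"
  shows "x \<otimes>\<^bsub>fox_group n Z z0\<^esub> y \<in> carrier (fox_group n Z z0)"
    and "fox_to_rhodes n Z z0 G \<phi> (x \<otimes>\<^bsub>fox_group n Z z0\<^esub> y)
      = fox_to_rhodes n Z z0 G \<phi> x \<otimes>\<^bsub>rhodes_group n Z z0 G \<phi>\<^esub> fox_to_rhodes n Z z0 G \<phi> y"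
proof -
  obtain a b where a: "x = fox_class n Z z0 a" "torus_loop n Z z0 a"
    and b: "y = fox_class n Z z0 b" "torus_loop n Z z0 b"
    using assms unfolding fox_group_carrier by blast
  note ab = torus_loop_concat[OF a(2) b(2)]
  have mult: "x \<otimes>\<^bsub>fox_group n Z z0\<^esub> y = fox_class n Z z0 (loop_concat a b)"
    unfolding a(1) b(1) by (rule fox_group_mult[OF a(2) b(2)])
  then show "x \<otimes>\<^bsub>fox_group n Z z0\<^esub> y \<in> carrier (fox_group n Z z0)"
    using ab unfolding fox_group_carrier by blast
  have ord: "of_order n Z z0 \<phi> \<one> (case_prod a)" "of_order n Z z0 \<phi> \<one> (case_prod b)"
    using a b by (auto simp: torus_loop_iff_of_order)
  show "fox_to_rhodes n Z z0 G \<phi> (x \<otimes>\<^bsub>fox_group n Z z0\<^esub> y)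
      = fox_to_rhodes n Z z0 G \<phi> x \<otimes>\<^bsub>rhodes_group n Z z0 G \<phi>\<^esub> fox_to_rhodes n Z z0 G \<phi> y"
    unfolding mult fox_to_rhodes_class[OF ab]
    unfolding a(1) b(1) fox_to_rhodes_class[OF a(2)] fox_to_rhodes_class[OF b(2)]
      rhodes_group_mult[OF one_closed one_closed ord] case_prod_loop_concat
    using order_class_eqI[OF homotopic_cyl_concat_order_one[OF ord]] by simp
qed

lemma inj_on_fox_to_rhodes: "inj_on (fox_to_rhodes n Z z0 G \<phi>) (carrier (fox_group n Z z0))"
proof (rule inj_onI)
  fix x y assume "x \<in> carrier (fox_group n Z z0)" "y \<in> carrier (fox_group n Z z0)"
    and eq: "fox_to_rhodes n Z z0 G \<phi> x = fox_to_rhodes n Z z0 G \<phi> y"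
  then obtain a b where a: "x = fox_class n Z z0 a" "torus_loop n Z z0 a"
    and b: "y = fox_class n Z z0 b" "torus_loop n Z z0 b"
    unfolding fox_group_carrier by blast
  have "of_order n Z z0 \<phi> \<one> (case_prod b)"
    using b by (auto simp: torus_loop_iff_of_order)
  moreover have "order_class n Z z0 \<phi> \<one> (case_prod a) = order_class n Z z0 \<phi> \<one> (case_prod b)"
    using eq unfolding a(1) b(1) fox_to_rhodes_class[OF a(2)] fox_to_rhodes_class[OF b(2)] by simp
  ultimately show "x = y"
    unfolding a(1) b(1) fox_class_eq_iff[OF a(2) b(2)] by (simp only: order_class_eq_iff)
qed

lemma fox_to_rhodes_image:
  "fox_to_rhodes n Z z0 G \<phi> ` carrier (fox_group n Z z0) = kernel (rhodes_group n Z z0 G \<phi>) G rhodes_proj"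
proof (intro equalityI subsetI)
  fix x assume "x \<in> fox_to_rhodes n Z z0 G \<phi> ` carrier (fox_group n Z z0)"
  then obtain f where f: "torus_loop n Z z0 f"
      "x = fox_to_rhodes n Z z0 G \<phi> (fox_class n Z z0 f)"
    unfolding fox_group_carrier by blast
  then show "x \<in> kernel (rhodes_group n Z z0 G \<phi>) G rhodes_proj"
    by (auto simp: fox_to_rhodes_class kernel_def rhodes_proj_def rhodes_group_carrier torus_loop_iff_of_order)
next
  fix x assume "x \<in> kernel (rhodes_group n Z z0 G \<phi>) G rhodes_proj"
  then obtain F where F: "of_order n Z z0 \<phi> \<one> F" "x = (order_class n Z z0 \<phi> \<one> F, \<one>)"
    by (auto simp: kernel_def rhodes_proj_def rhodes_group_carrier)
  obtain f where f: "torus_loop n Z z0 f"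
      "order_class n Z z0 \<phi> \<one> (case_prod f) = order_class n Z z0 \<phi> \<one> F"
    using loop_of_order_one_map[OF F(1)] .
  then have "x = fox_to_rhodes n Z z0 G \<phi> (fox_class n Z z0 f)"
    using F(2) by (simp add: fox_to_rhodes_class)
  then show "x \<in> fox_to_rhodes n Z z0 G \<phi> ` carrier (fox_group n Z z0)"
    using f(1) unfolding fox_group_carrier by blast
qed

text \<open>Since the map to the Rhodes group is injective and multiplicative with a kernel as its image,
no further homotopies have to be constructed.\<close>

lemma group_fox_group: "group (fox_group n Z z0)"
proof (rule group_if_embeds[OF group_rhodes_group])
  show "subgroup (fox_to_rhodes n Z z0 G \<phi> ` carrier (fox_group n Z z0)) (rhodes_group n Z z0 G \<phi>)"
    unfolding fox_to_rhodes_image by (rule group_hom.subgroup_kernel[OF group_hom_rhodes_proj])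
  show "\<one>\<^bsub>fox_group n Z z0\<^esub> \<in> carrier (fox_group n Z z0)"
    unfolding fox_group_one fox_group_carrier using torus_loop_const by blast
qed (simp_all add: inj_on_fox_to_rhodes fox_to_rhodes_mult fox_to_rhodes_one)

lemma group_hom_fox_to_rhodes:
  "group_hom (fox_group n Z z0) (rhodes_group n Z z0 G \<phi>) (fox_to_rhodes n Z z0 G \<phi>)"
proof (intro group_hom.intro group_hom_axioms.intro group_fox_group group_rhodes_group homI)
  fix x assume "x \<in> carrier (fox_group n Z z0)"
  then have "fox_to_rhodes n Z z0 G \<phi> x \<in> kernel (rhodes_group n Z z0 G \<phi>) G rhodes_proj"
    using fox_to_rhodes_image by blast
  then show "fox_to_rhodes n Z z0 G \<phi> x \<in> carrier (rhodes_group n Z z0 G \<phi>)"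
    by (simp add: kernel_def)
qed (rule fox_to_rhodes_mult)

end

context pointed_G_map
begin

text \<open>On representatives both composites are \<open>h\<close> after \<open>f\<close>, up to the values outside the cylinder.
Naturality also makes the induced map of Fox groups a homomorphism, since the corresponding
map of Rhodes groups is one.\<close>

lemma fox_induced_natural:
  assumes "x \<in> carrier (fox_group n Z z0)"
  shows "fox_induced n W w0 h x \<in> carrier (fox_group n W w0)"
    and "fox_to_rhodes n W w0 G \<psi> (fox_induced n W w0 h x)
      = rhodes_induced n W w0 \<psi> h (fox_to_rhodes n Z z0 G \<phi> x)"
proof -
  let ?T = "topspace (torus (n - 1))"
  let ?c = "\<lambda>f t. compose ?T h (f t)"
  obtain f where f: "x = fox_class n Z z0 f" "torus_loop n Z z0 f"
    using assms unfolding Z.fox_group_carrier by blast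
  have comp: "homotopic_with (order_ends n w0 \<psi> \<one>) (cylinder n) W (h \<circ> case_prod f) (case_prod (?c f))"
    if "torus_loop n Z z0 f" for f
  proof (rule homotopic_of_order_equal[OF of_order_comp])
    show "of_order n Z z0 \<phi> \<one> (case_prod f)"
      using that by (simp add: Z.torus_loop_iff_of_order)
  qed (auto simp: topspace_cylinder compose_def)
  have loop: "torus_loop n W w0 (?c f)"
    if "torus_loop n Z z0 f" for f
    using of_order_if_homotopic(2)[OF comp[OF that]] by (simp add: W.torus_loop_iff_of_order)
  have "(\<Union>f'\<in>fox_class n Z z0 f. fox_class n W w0 (?c f')) = fox_class n W w0 (?c f)"
  proof (rule Z.UN_fox_class[OF f(2)])
    fix f' assume f': "torus_loop n Z z0 f'"
      and hom: "homotopic_with (order_ends n z0 \<phi> \<one>) (cylinder n) Z (case_prod f) (case_prod f')"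
    have "homotopic_with (order_ends n w0 \<psi> \<one>) (cylinder n) W (case_prod (?c f)) (case_prod (?c f'))"
      by (rule homotopic_with_trans[OF homotopic_with_trans[OF
            homotopic_with_symD[OF comp[OF f(2)]] homotopic_comp[OF _ hom]] comp[OF f']]) simp
    then show "fox_class n W w0 (?c f') = fox_class n W w0 (?c f)"
      unfolding W.fox_class_eq_iff[OF loop[OF f'] loop[OF f(2)]] by (rule homotopic_with_symD)
  qed
  then have ind: "fox_induced n W w0 h x = fox_class n W w0 (?c f)"
    unfolding f(1) fox_induced_def .
  show "fox_induced n W w0 h x \<in> carrier (fox_group n W w0)"
    using loop[OF f(2)] unfolding ind W.fox_group_carrier by blast
  have "of_order n Z z0 \<phi> \<one> (case_prod f)"
    using f(2) by (simp add: Z.torus_loop_iff_of_order)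
  then show "fox_to_rhodes n W w0 G \<psi> (fox_induced n W w0 h x)
      = rhodes_induced n W w0 \<psi> h (fox_to_rhodes n Z z0 G \<phi> x)"
    unfolding ind W.fox_to_rhodes_class[OF loop[OF f(2)]] unfolding f(1) Z.fox_to_rhodes_class[OF f(2)]
    using order_class_eqI[OF comp[OF f(2)]] by (simp add: rhodes_induced_class)
qed

lemma group_hom_fox_induced:
  "group_hom (fox_group n Z z0) (fox_group n W w0) (fox_induced n W w0 h)"
proof (intro group_hom.intro group_hom_axioms.intro Z.group_fox_group W.group_fox_group homI)
  interpret R: group_hom "rhodes_group n Z z0 G \<phi>" "rhodes_group n W w0 G \<psi>" "rhodes_induced n W w0 \<psi> h"
    by (rule group_hom_rhodes_induced)
  interpret FZ: group_hom "fox_group n Z z0" "rhodes_group n Z z0 G \<phi>" "fox_to_rhodes n Z z0 G \<phi>"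
    by (rule Z.group_hom_fox_to_rhodes)
  interpret FW: group_hom "fox_group n W w0" "rhodes_group n W w0 G \<psi>" "fox_to_rhodes n W w0 G \<psi>"
    by (rule W.group_hom_fox_to_rhodes)
  fix x assume x: "x \<in> carrier (fox_group n Z z0)"
  then show "fox_induced n W w0 h x \<in> carrier (fox_group n W w0)"
    by (rule fox_induced_natural)
  fix y assume y: "y \<in> carrier (fox_group n Z z0)"
  show "fox_induced n W w0 h (x \<otimes>\<^bsub>fox_group n Z z0\<^esub> y)
      = fox_induced n W w0 h x \<otimes>\<^bsub>fox_group n W w0\<^esub> fox_induced n W w0 h y"
    using x y by (intro inj_onD[OF W.inj_on_fox_to_rhodes[of n]]) (simp_all add: fox_induced_natural)
qed

end

section \<open>The space of self-maps as a G-space\<close>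

lemma id_map_in_mapping_space: "id_map X \<in> topspace (mapping_space X X)"
  by (auto simp: topspace_mapping_space id_map_def intro: continuous_map_eq[OF continuous_map_id])

lemma topspace_mapping_space_compose:
  assumes "continuous_map Z W h" "f \<in> topspace (mapping_space T Z)"
  shows "compose (topspace T) h f \<in> topspace (mapping_space T W)"
  using continuous_map_postcompose[OF assms(1), of T] assms(2) by (auto simp: continuous_map_def)

context pointed_G_space
begin

lemma G_space_pointwise_action: "G_space G (mapping_space Z Z) (pointwise_action Z \<phi>)"
  unfolding G_space_def
proof
  let ?M = "topspace (mapping_space Z Z)" and ?p = "pointwise_action Z \<phi>"
  have p: "?p g f = compose (topspace Z) (\<phi> g) f" if "f \<in> ?M" for g f
    using that by (simp add: pointwise_action_def)
  have pM: "?p g f \<in> ?M" if "g \<in> carrier G" "f \<in> ?M" for g f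
    using topspace_mapping_space_compose[OF act_continuous] that by (simp add: p)
  have val: "f z \<in> topspace Z" if "f \<in> ?M" "z \<in> topspace Z" for f z
    using that by (auto simp: topspace_mapping_space continuous_map_def)
  have ext: "f \<in> extensional (topspace Z)" if "f \<in> ?M" for f
    using that by (simp add: topspace_mapping_space)
  have pp: "?p (g \<otimes> k) f = ?p g (?p k f)" if "g \<in> carrier G" "k \<in> carrier G" "f \<in> ?M" for g k f
  proof -
    have "?p (g \<otimes> k) f = compose (topspace Z) (\<phi> g) (compose (topspace Z) (\<phi> k) f)"
      unfolding p[OF that(3)] compose_def
      by (rule restrict_ext) (use that val in \<open>simp add: act_mult\<close>)
    moreover have "?p g (?p k f) = compose (topspace Z) (\<phi> g) (?p k f)"
      by (rule p[OF pM[OF that(2,3)]])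
    ultimately show ?thesis
      using p[OF that(3), of k] by metis
  qed
  have p1: "?p \<one> f = f" if "f \<in> ?M" for f
    by (rule extensionalityI[where A = "topspace Z"])
      (use that val ext pM[OF one_closed that] in \<open>auto simp: p compose_def act_one\<close>)
  have bij: "?p g \<in> Bij ?M" if "g \<in> carrier G" for g
  proof -
    have "bij_betw (?p g) ?M ?M"
      by (rule bij_betw_byWitness[where f' = "?p (inv g)"])
        (use that pM p1 pp[of g "inv g"] pp[of "inv g" g] in auto)
    then show ?thesis
      by (simp add: Bij_def pointwise_action_def)
  qed
  have "?p \<in> hom G (BijGroup ?M)"
  proof (rule homI)
    fix g k assume gk: "g \<in> carrier G" "k \<in> carrier G"
    show "?p g \<in> carrier (BijGroup ?M)"
      using bij gk by (simp add: BijGroup_def)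
    have "?p (g \<otimes> k) = compose ?M (?p g) (?p k)"
      by (rule extensionalityI[where A = ?M])
        (use gk pp bij in \<open>auto simp: compose_def Bij_def\<close>)
    then show "?p (g \<otimes> k) = ?p g \<otimes>\<^bsub>BijGroup ?M\<^esub> ?p k"
      using bij gk by (simp add: BijGroup_def)
  qed
  then show "group_action G ?M ?p"
    by (intro group_action.intro group_hom.intro group_hom_axioms.intro is_group group_BijGroup)
  show "\<forall>g\<in>carrier G. continuous_map (mapping_space Z Z) (mapping_space Z Z) (?p g)"
    using p by (auto intro!: continuous_map_eq[OF continuous_map_postcompose[OF act_continuous]])
qed

lemma pointed_G_map_evaluation:
  "pointed_G_map G (mapping_space Z Z) (id_map Z) (pointwise_action Z \<phi>) Z z0 \<phi> (\<lambda>F. F z0)"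
proof (intro pointed_G_map.intro pointed_G_map_axioms.intro)
  show "pointed_G_space G (mapping_space Z Z) (id_map Z) (pointwise_action Z \<phi>)"
    by (intro pointed_G_space.intro pointed_G_space_axioms.intro is_group G_space_pointwise_action
        id_map_in_mapping_space)
  show "pointed_G_space G Z z0 \<phi>"
    by (rule pointed_G_space_axioms)
  show "continuous_map (mapping_space Z Z) Z (\<lambda>F. F z0)"
    using base by (rule continuous_map_eval_at)
  show "id_map Z z0 = z0"
    using base by (simp add: id_map_def)
  show "pointwise_action Z \<phi> g F z0 = \<phi> g (F z0)" if "F \<in> topspace (mapping_space Z Z)" for g F
    using that base by (simp add: pointwise_action_def compose_def)
qed

lemma pointwise_action_id_map:
  "pointwise_action Z \<phi> g (id_map Z) = restrict (\<phi> g) (topspace Z)"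
  using id_map_in_mapping_space[of Z]
  by (auto simp: pointwise_action_def compose_def id_map_def intro!: restrict_ext)

text \<open>From a homotopy one gets a path in the space of self-maps, and composing it with the projection of
the cylinder to the interval gives a map of order \<open>g\<close>. Conversely one restricts a map of order \<open>g\<close>
to the segment over a point of the torus; that this path is a homotopy is where
\<open>Z\<close> has to be a Hausdorff k-space.\<close>

lemma homotopic_to_id_iff_order_map:
  assumes Z: "k_space Z" "Hausdorff_space Z"
  shows "homotopic_with (\<lambda>_. True) Z Z (\<phi> g) (id_map Z) \<longleftrightarrow>
    (\<exists>F. of_order n (mapping_space Z Z) (id_map Z) (pointwise_action Z \<phi>) g F)"
proof
  assume "homotopic_with (\<lambda>_. True) Z Z (\<phi> g) (id_map Z)"
  then have "homotopic_with (\<lambda>_. True) Z Z (id_map Z) (\<phi> g)"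
    by (rule homotopic_with_symD)
  then obtain H where H: "continuous_map (prod_topology unit_interval Z) Z H"
      "\<And>z. H (0, z) = id_map Z z" "\<And>z. H (1, z) = \<phi> g z"
    unfolding homotopic_with_def by blast
  let ?F = "(\<lambda>t. \<lambda>z\<in>topspace Z. H (t, z)) \<circ> fst"
  have "continuous_map (cylinder n) (mapping_space Z Z) ?F"
    unfolding cylinder_def by (rule continuous_map_compose[OF continuous_map_fst continuous_map_curry[OF H(1)]])
  moreover have "order_ends n (id_map Z) (pointwise_action Z \<phi>) g ?F"
    unfolding order_ends_def pointwise_action_id_map
    by (auto simp: H id_map_def restrict_def)
  ultimately show "\<exists>F. of_order n (mapping_space Z Z) (id_map Z) (pointwise_action Z \<phi>) g F"
    unfolding of_order_def by blast
next
  assume "\<exists>F. of_order n (mapping_space Z Z) (id_map Z) (pointwise_action Z \<phi>) g F"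
  then obtain F where F: "continuous_map (cylinder n) (mapping_space Z Z) F"
      "order_ends n (id_map Z) (pointwise_action Z \<phi>) g F"
    by (auto simp: of_order_def)
  obtain s where s: "s \<in> topspace (torus (n - 1))"
    using torus_nonempty by blast
  have "continuous_map unit_interval (cylinder n) (\<lambda>t. (t, s))"
    using s unfolding cylinder_def by (simp add: continuous_map_pairwise o_def)
  from continuous_map_compose[OF this F(1)]
  have "continuous_map unit_interval (mapping_space Z Z) (\<lambda>t. F (t, s))"
    by (simp add: o_def)
  from path_in_mapping_space_imp_homotopic[OF Z this]
  have "homotopic_with (\<lambda>_. True) Z Z (id_map Z) (restrict (\<phi> g) (topspace Z))"
    using F(2) s by (simp add: order_ends_def pointwise_action_id_map)
  then have "homotopic_with (\<lambda>_. True) Z Z (id_map Z) (\<phi> g)"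
    by (rule homotopic_with_eq) auto
  then show "homotopic_with (\<lambda>_. True) Z Z (\<phi> g) (id_map Z)"
    by (rule homotopic_with_symD)
qed

lemma rhodes_proj_gottlieb_image:
  assumes Z: "k_space Z" "Hausdorff_space Z"
  shows "rhodes_proj ` carrier (gottlieb_rhodes_group n Z z0 G \<phi>) = carrier (homotopic_id_subgroup Z G \<phi>)"
proof -
  let ?R = "rhodes_group n (mapping_space Z Z) (id_map Z) G (pointwise_action Z \<phi>)"
  interpret ev: pointed_G_map G "mapping_space Z Z" "id_map Z" "pointwise_action Z \<phi>" Z z0 \<phi> "\<lambda>F. F z0"
    by (rule pointed_G_map_evaluation)
  have "rhodes_proj ` carrier (gottlieb_rhodes_group n Z z0 G \<phi>) = snd ` carrier ?R"
    by (simp add: gottlieb_rhodes_group_def rhodes_proj_def image_image ev.rhodes_induced_snd)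
  also have "\<dots> = {g \<in> carrier G. \<exists>F. of_order n (mapping_space Z Z) (id_map Z) (pointwise_action Z \<phi>) g F}"
    unfolding ev.Z.rhodes_group_carrier by force
  also have "\<dots> = carrier (homotopic_id_subgroup Z G \<phi>)"
    by (simp add: homotopic_id_subgroup_def homotopic_to_id_iff_order_map[OF Z, symmetric])
  finally show ?thesis .
qed

end

section \<open>The exact sequence\<close>

theorem theorem2p2:
  fixes G :: "('g, 'r) monoid_scheme" and X :: "'a topology"
    and \<phi> :: "'g \<Rightarrow> 'a \<Rightarrow> 'a" and x0 :: 'a and n :: nat
  assumes "group G" and "finite (carrier G)"
    and "G_space G X \<phi>"
    and "k_space X" and "Hausdorff_space X" and "path_connected_space X"
    and "x0 \<in> topspace X"
    and "n \<ge> 1"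
  shows "subgroup (carrier (homotopic_id_subgroup X G \<phi>)) G \<and>
    subgroup (carrier (gottlieb_fox_group n X x0)) (fox_group n X x0) \<and>
    subgroup (carrier (gottlieb_rhodes_group n X x0 G \<phi>)) (rhodes_group n X x0 G \<phi>) \<and>
    short_exact
      (gottlieb_fox_group n X x0) (fox_to_rhodes n X x0 G \<phi>)
      (gottlieb_rhodes_group n X x0 G \<phi>) rhodes_proj
      (homotopic_id_subgroup X G \<phi>)"
proof -
  interpret X: pointed_G_space G X x0 \<phi>
    using assms by (intro pointed_G_space.intro pointed_G_space_axioms.intro)
  interpret ev: pointed_G_map G "mapping_space X X" "id_map X" "pointwise_action X \<phi>" X x0 \<phi> "\<lambda>F. F x0"
    by (rule X.pointed_G_map_evaluation)
  let ?M = "mapping_space X X" and ?a = "pointwise_action X \<phi>" and ?ev = "\<lambda>F. F x0"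
  let ?FM = "fox_group n ?M (id_map X)" and ?RM = "rhodes_group n ?M (id_map X) G ?a"
  let ?F = "fox_group n X x0" and ?R = "rhodes_group n X x0 G \<phi>"
  let ?GF = "gottlieb_fox_group n X x0" and ?GR = "gottlieb_rhodes_group n X x0 G \<phi>"
  let ?G0 = "homotopic_id_subgroup X G \<phi>"
  let ?i = "fox_to_rhodes n X x0 G \<phi>" and ?iM = "fox_to_rhodes n ?M (id_map X) G ?a"
  let ?eF = "fox_induced n X x0 ?ev" and ?eR = "rhodes_induced n X x0 \<phi> ?ev"
  have GF: "carrier ?GF = ?eF ` carrier ?FM" and GR: "carrier ?GR = ?eR ` carrier ?RM"
    by (simp_all add: gottlieb_fox_group_def gottlieb_rhodes_group_def)
  have sF: "subgroup (carrier ?GF) ?F"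
    unfolding GF by (rule group_hom.img_is_subgroup[OF ev.group_hom_fox_induced])
  have sR: "subgroup (carrier ?GR) ?R"
    unfolding GR by (rule group_hom.img_is_subgroup[OF ev.group_hom_rhodes_induced])
  have surj: "rhodes_proj ` carrier ?GR = carrier ?G0"
    by (rule X.rhodes_proj_gottlieb_image[OF assms(4,5)])
  have s0: "subgroup (carrier ?G0) G"
    unfolding surj[symmetric]
    by (rule group_hom.subgroup_img_is_subgroup[OF X.group_hom_rhodes_proj sR])
  have i_ev: "?i ` carrier ?GF = ?eR ` kernel ?RM G rhodes_proj"
    unfolding GF ev.Z.fox_to_rhodes_image[symmetric] image_image
    by (rule image_cong[OF refl]) (rule ev.fox_induced_natural(2))
  have ker_ev: "kernel ?GR ?G0 rhodes_proj = ?eR ` kernel ?RM G rhodes_proj"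
    unfolding kernel_def GR
    by (auto simp: rhodes_proj_def ev.rhodes_induced_snd homotopic_id_subgroup_def)
  have GF_eq: "?GF = ?F\<lparr>carrier := carrier ?GF\<rparr>" and GR_eq: "?GR = ?R\<lparr>carrier := carrier ?GR\<rparr>"
    and G0_eq: "?G0 = G\<lparr>carrier := carrier ?G0\<rparr>"
    by (simp_all add: gottlieb_fox_group_def gottlieb_rhodes_group_def homotopic_id_subgroup_def)
  have exact: "kernel ?GR ?G0 rhodes_proj = ?i ` carrier ?GF"
    using i_ev ker_ev by simp
  have groups: "group ?GF" "group ?GR" "group ?G0"
    using subgroup.subgroup_is_group[OF sF X.group_fox_group] subgroup.subgroup_is_group[OF sR X.group_rhodes_group]
      subgroup.subgroup_is_group[OF s0 assms(1)]
    unfolding GF_eq[symmetric] GR_eq[symmetric] G0_eq[symmetric] by blast+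
  have "?i ` carrier ?GF \<subseteq> carrier ?GR"
    unfolding exact[symmetric] by (auto simp: kernel_def)
  moreover have "?i (x \<otimes>\<^bsub>?GF\<^esub> y) = ?i x \<otimes>\<^bsub>?GR\<^esub> ?i y" if "x \<in> carrier ?GF" "y \<in> carrier ?GF" for x y
    using X.fox_to_rhodes_mult(2)[of x n y] that subgroup.subset[OF sF]
    by (subst GF_eq, subst GR_eq) auto
  ultimately have "?i \<in> hom ?GF ?GR"
    by (intro homI) blast+
  with groups have hi: "group_hom ?GF ?GR ?i"
    by (intro group_hom.intro group_hom_axioms.intro)
  have "rhodes_proj (x \<otimes>\<^bsub>?GR\<^esub> y) = rhodes_proj x \<otimes>\<^bsub>?G0\<^esub> rhodes_proj y"
    if "x \<in> carrier ?GR" "y \<in> carrier ?GR" for x y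
    using group_hom.hom_mult[OF X.group_hom_rhodes_proj, of x n y] that subgroup.subset[OF sR]
    by (subst GR_eq, subst G0_eq) auto
  then have "rhodes_proj \<in> hom ?GR ?G0"
    using surj by (intro homI) blast+
  with groups have hp: "group_hom ?GR ?G0 rhodes_proj"
    by (intro group_hom.intro group_hom_axioms.intro)
  have "inj_on ?i (carrier ?GF)"
    using X.inj_on_fox_to_rhodes subgroup.subset[OF sF] by (rule inj_on_subset)
  then have "kernel ?GF ?GR ?i = {\<one>\<^bsub>?GF\<^esub>}"
    using group_hom.inj_iff_trivial_ker[OF hi] by simp
  then show ?thesis
    unfolding short_exact_def using s0 sF sR hi hp exact surj by blast
qed

end
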